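(* There exists a constant $C\ge 1$ and a universal constant $c>0$ such that the following holds. Let $n\ge 1$ and let $\mu$ be any probability distribution on subsets of $[n]=\{1,\dots,n\}$ with $\mathbb E_{S\sim\mu}|S|^2\ge C$. For distinct $u,v\in[n]$ let $W(u,v)=\Pr_{S\sim\mu}[u,v\in S]$. Then $$\mathsf{cr}(K_n;W) \ge \frac{c}{n}\left(\mathbb E_{S\sim\mu}|S|^2\right)^{5/2},$$ where $K_n$ is the complete graph on $[n]$.
   Context: For a graph $H=(U,F)$ with non-negative edge weights $W:F\to[0,\infty)$, a drawing of $H$ in the plane places the vertices at distinct points and draws each edge as a curve between its endpoints. The crossing weight of a drawing is the total weight of all edge crossings, where each crossing between edges $e,e'$ contributes $W(e)\cdot W(e')$. $\mathsf{cr}(H;W)$ denotes the minimum crossing weight over all drawings of $H$ in the plane. *)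

theory Defs
  imports "HOL-Probability.Probability"
begin

text \<open>Graphs: vertex set V :: nat set, edge set E of pairs (u,v) with u < v.
  A drawing places vertex x at the point p x of the plane (complex numbers) and
  draws edge (u,v) as an arc (simple curve) from p u to p v whose only vertex
  points are its endpoints; distinct edges meet in finitely many points.\<close>

definition is_drawing ::
  "nat set \<Rightarrow> (nat \<times> nat) set \<Rightarrow> (nat \<Rightarrow> complex) \<Rightarrow> (nat \<times> nat \<Rightarrow> real \<Rightarrow> complex) \<Rightarrow> bool" where
  "is_drawing V E p \<gamma> \<longleftrightarrow>
     inj_on p V \<and>
     (\<forall>u v. (u, v) \<in> E \<longrightarrow>
        arc (\<gamma> (u, v)) \<and> pathstart (\<gamma> (u, v)) = p u \<and> pathfinish (\<gamma> (u, v)) = p v \<and>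
        path_image (\<gamma> (u, v)) \<inter> p ` V \<subseteq> {p u, p v}) \<and>
     (\<forall>e\<in>E. \<forall>e'\<in>E. e \<noteq> e' \<longrightarrow> finite (path_image (\<gamma> e) \<inter> path_image (\<gamma> e')))"

definition edge_crossings ::
  "nat set \<Rightarrow> (nat \<Rightarrow> complex) \<Rightarrow> (nat \<times> nat \<Rightarrow> real \<Rightarrow> complex) \<Rightarrow> nat \<times> nat \<Rightarrow> nat \<times> nat \<Rightarrow> nat" where
  "edge_crossings V p \<gamma> e e' = card (path_image (\<gamma> e) \<inter> path_image (\<gamma> e') - p ` V)"

text \<open>Crossing weight: sum over unordered pairs of distinct edges (hence the factor 1/2
  over ordered pairs) of W(e) W(e') times the number of crossings.\<close>
definition crossing_weight ::
  "nat set \<Rightarrow> (nat \<times> nat) set \<Rightarrow> (nat \<times> nat \<Rightarrow> real) \<Rightarrow> (nat \<Rightarrow> complex) \<Rightarrow> (nat \<times> nat \<Rightarrow> real \<Rightarrow> complex) \<Rightarrow> real" where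
  "crossing_weight V E W p \<gamma> =
     (1/2) * (\<Sum>(e, e') \<in> {(e, e'). e \<in> E \<and> e' \<in> E \<and> e \<noteq> e'}.
                 W e * W e' * real (edge_crossings V p \<gamma> e e'))"

definition weighted_crossing_number ::
  "nat set \<Rightarrow> (nat \<times> nat) set \<Rightarrow> (nat \<times> nat \<Rightarrow> real) \<Rightarrow> real" where
  "weighted_crossing_number V E W =
     Inf {crossing_weight V E W p \<gamma> | p \<gamma>. is_drawing V E p \<gamma>}"

definition Kn_edges :: "nat \<Rightarrow> (nat \<times> nat) set" where
  "Kn_edges n = {(u, v). u \<in> {1..n} \<and> v \<in> {1..n} \<and> u < v}"

end

theory Submission
  imports Defs
begin

text \<open>Let \<open>M\<close> be the second moment of the size of \<open>S\<close>, and \<open>a u\<close> the probability that \<open>u\<close> lies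
  in \<open>S\<close>. A graph with more than \<open>2048\<close> times as many edges as vertices contains a subdivision of
  \<open>K\<^sub>5\<close> (Mader), so in every drawing two of its disjoint edges cross. Sampling the vertices with
  probability \<open>q\<close> turns this into a crossing lemma
  \<open>cr \<ge> q\<^sup>-\<^sup>2 e - 2048 q\<^sup>-\<^sup>3 v\<close> that counts crossings of disjoint edges only. It is applied to
  the level graphs of \<open>W\<close>: an edge of weight at least \<open>t\<close> has both ends in the set \<open>a u \<ge> t\<close>
  since \<open>W (u, v) \<le> min (a u) (a v)\<close>. With \<open>q\<close> equal to the minimum of \<open>1\<close> and \<open>\<sigma> sqrt t\<close>,
  summation over dyadic levels bounds the crossing weight from below by a multiple of
  \<open>\<sigma>\<^sup>-\<^sup>2 (\<Sum> W - O(\<Sum> a) - O(\<Sum> sqrt a) / \<sigma>)\<close>. Here \<open>\<Sum> W\<close> is about \<open>M / 2\<close>, while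
  \<open>\<Sum> a \<le> sqrt M\<close> and \<open>(\<Sum> sqrt a)\<^sup>2 \<le> n sqrt M\<close> by Cauchy-Schwarz; the choice of \<open>\<sigma>\<^sup>2\<close> as a
  large multiple of \<open>n M\<^sup>-\<^sup>3\<^sup>/\<^sup>2\<close> gives the claim.\<close>

section \<open>Independent crossings in drawings of the complete graph on five vertices\<close>

text \<open>\<open>q t - r t\<close> has the constant exponential \<open>c\<close>, so its values
  lie in one translate of the multiples of \<open>2 * pi * \<i>\<close>. A continuous function on an
  interval with such a discrete range is constant.\<close>

lemma increment_unique:
  fixes q r :: "real \<Rightarrow> complex"
  assumes "continuous_on {0..1} q" "continuous_on {0..1} r"
    and eq: "\<And>t. t \<in> {0..1} \<Longrightarrow> exp (q t) = c * exp (r t)"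
  shows "q 1 - q 0 = r 1 - r 0"
proof -
  have "(\<lambda>t. q t - r t) constant_on {0..1}"
  proof (rule continuous_discrete_range_constant)
    show "connected {0..1::real}" by simp
    show "continuous_on {0..1} (\<lambda>t. q t - r t)"
      using assms by (intro continuous_intros) auto
    show "\<exists>e>0. \<forall>y. y \<in> {0..1} \<and> q y - r y \<noteq> q x - r x \<longrightarrow> e \<le> cmod (q y - r y - (q x - r x))"
      if x: "x \<in> {0..1}" for x
    proof -
      have "q y - r y = q x - r x"
        if y: "y \<in> {0..1}" "cmod (q y - r y - (q x - r x)) < 2 * pi" for y
      proof (rule exp_complex_eqI)
        have "\<bar>Im (q y - r y) - Im (q x - r x)\<bar> \<le> cmod (q y - r y - (q x - r x))"
          by (metis abs_Im_le_cmod minus_complex.simps(2))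
        then show "\<bar>Im (q y - r y) - Im (q x - r x)\<bar> < 2 * pi"
          using y by linarith
        show "exp (q y - r y) = exp (q x - r x)"
          using eq[OF x] eq[OF y(1)] by (simp add: exp_diff)
      qed
      then show ?thesis
        by (rule_tac x="2*pi" in exI) (meson linorder_not_le pi_gt_zero zero_less_mult_iff zero_less_numeral)
    qed
  qed
  then obtain a where a: "\<And>t. t \<in> {0..1} \<Longrightarrow> q t - r t = a"
    by (auto simp: constant_on_def)
  have "q 1 - r 1 = q 0 - r 0" using a[of 0] a[of 1] by simp
  then show ?thesis by (simp add: algebra_simps)
qed

text \<open>The change of a continuous logarithm along \<open>f\<close>; its imaginary part is the
  total angle swept around 0. When such a logarithm exists the choice is immaterial by
  \<open>increment_unique\<close>.\<close>

definition log_increment :: "(real \<Rightarrow> complex) \<Rightarrow> complex" where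
  "log_increment f = (SOME d. \<exists>q. continuous_on {0..1} q \<and>
     (\<forall>t\<in>{0..1}. exp (q t) = f t) \<and> d = q 1 - q 0)"

text \<open>A nonzero constant factor shifts the logarithm by \<open>Ln c\<close>, which cancels in
  the increment. The form with \<open>c\<close> allows a change of sign of \<open>f\<close>.\<close>

lemma log_increment_eqI:
  assumes q: "continuous_on {0..1} q" and c: "c \<noteq> 0"
    and eq: "\<And>t. t \<in> {0..1} \<Longrightarrow> f t = c * exp (q t)"
  shows "log_increment f = q 1 - q 0"
proof -
  let ?P = "\<lambda>d. \<exists>q. continuous_on {0..1} q \<and> (\<forall>t\<in>{0..1}. exp (q t) = f t) \<and> d = q 1 - q 0"
  have "?P (q 1 - q 0)"
  proof (intro exI conjI ballI)
    show "continuous_on {0..1} (\<lambda>t. Ln c + q t)" using q by (intro continuous_intros)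
    show "exp (Ln c + q t) = f t" if "t \<in> {0..1}" for t
      using eq[OF that] c by (simp add: exp_add)
  qed simp
  then have "?P (log_increment f)" unfolding log_increment_def by (rule someI)
  then obtain r where r: "continuous_on {0..1} r" "\<And>t. t \<in> {0..1} \<Longrightarrow> exp (r t) = f t"
    "log_increment f = r 1 - r 0" by blast
  show ?thesis
    unfolding r(3) by (rule increment_unique[OF r(1) q]) (simp add: r(2) eq)
qed

text \<open>A continuous logarithm exists because the interval is contractible; at either end it
  differs from the prescribed logarithm by a multiple of \<open>2 * pi * \<i>\<close>.\<close>

lemma log_increment_int:
  assumes f: "continuous_on {0..1} f" "\<And>t. t \<in> {0..1} \<Longrightarrow> f t \<noteq> 0"
    and "exp a = f 0" "exp b = f 1"
  shows "\<exists>k::int. log_increment f = b - a + 2 * pi * \<i> * k"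
proof -
  obtain q where q: "continuous_on {0..1} q" "\<And>t. t \<in> {0..1} \<Longrightarrow> f t = exp (q t)"
    using continuous_logarithm_on_contractible[OF f(1) convex_imp_contractible] f(2)
    by (metis convex_closed_interval cbox_interval convex_box(1))
  have "log_increment f = q 1 - q 0" by (rule log_increment_eqI[OF q(1), of 1]) (auto simp: q(2))
  moreover have "exp (q 0) = exp a" "exp (q 1) = exp b" using q(2) assms by auto
  then obtain m n :: int where "q 0 = a + (of_int (2 * m) * pi) * \<i>" "q 1 = b + (of_int (2 * n) * pi) * \<i>"
    unfolding exp_eq by blast
  ultimately have "log_increment f = b - a + 2 * pi * \<i> * (of_int (n - m))"
    by (simp add: algebra_simps)
  then show ?thesis by blast
qed

text \<open>The four terms are the increments of a logarithm of \<open>g s - h t\<close> along the sides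
  of the unit square.\<close>
lemma log_increment_square:
  assumes "path g" "path h" "path_image g \<inter> path_image h = {}"
  shows "log_increment (\<lambda>t. g t - h 0) + log_increment (\<lambda>t. h t - g 1)
       = log_increment (\<lambda>t. g t - h 1) + log_increment (\<lambda>t. h t - g 0)"
proof -
  let ?S = "{0..1::real} \<times> {0..1::real}"
  have "continuous_on ?S (\<lambda>z. g (fst z))" "continuous_on ?S (\<lambda>z. h (snd z))"
    using continuous_on_compose2[OF _ continuous_on_fst[OF continuous_on_id], of "{0..1}" g ?S]
      continuous_on_compose2[OF _ continuous_on_snd[OF continuous_on_id], of "{0..1}" h ?S] assms(1,2)
    unfolding path_def by auto
  then have 1: "continuous_on ?S (\<lambda>z. g (fst z) - h (snd z))"
    by (rule continuous_on_diff)
  have 2: "contractible ?S"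
    using convex_Times[OF convex_real_interval(5) convex_real_interval(5)] convex_imp_contractible
    by blast
  have 3: "g (fst z) - h (snd z) \<noteq> 0" if "z \<in> ?S" for z
  proof -
    have "g (fst z) \<in> path_image g" "h (snd z) \<in> path_image h"
      using that by (auto simp: path_image_def)
    then show ?thesis using assms(3) by (metis IntI empty_iff eq_iff_diff_eq_0)
  qed
  obtain L where L: "continuous_on ?S L" "\<And>z. z \<in> ?S \<Longrightarrow> g (fst z) - h (snd z) = exp (L z)"
    using continuous_logarithm_on_contractible[OF 1 2 3] by blast
  have cont: "continuous_on {0..1} (\<lambda>t. L (t, c))" "continuous_on {0..1} (\<lambda>t. L (c, t))"
    if "c \<in> {0..1}" for c
    using that
    by (auto intro!: continuous_on_compose2[OF L(1) continuous_on_Pair[OF continuous_on_id continuous_on_const]]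
        continuous_on_compose2[OF L(1) continuous_on_Pair[OF continuous_on_const continuous_on_id]])
  have g: "log_increment (\<lambda>t. g t - h c) = L (1, c) - L (0, c)" if "c \<in> {0..1}" for c
    by (rule log_increment_eqI[OF cont(1)[OF that], of 1]) (use that L(2)[of "(_, c)"] in auto)
  \<comment> \<open>Here the difference has the opposite sign to the one whose logarithm is
    \<open>L\<close>; this is the constant factor -1.\<close>
  have h: "log_increment (\<lambda>t. h t - g c) = L (c, 1) - L (c, 0)" if "c \<in> {0..1}" for c
  proof (rule log_increment_eqI[OF cont(2)[OF that], of "-1"])
    show "h t - g c = -1 * exp (L (c, t))" if "t \<in> {0..1}" for t
      using L(2)[of "(c, t)"] that \<open>c \<in> {0..1}\<close> by (metis fst_conv snd_conv SigmaI minus_diff_eq mult_minus1)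
  qed simp
  show ?thesis by (simp add: g h)
qed

text \<open>A van Kampen type parity argument. Relative to fixed logarithms of the differences
  \<open>b j - b i\<close> the increments give integers \<open>k\<close>; every one of them occurs in
  exactly two of the fifteen square relations, while half the constant terms of these relations
  add up to an odd number, as for a convex pentagon.\<close>
lemma K5_independent_crossing:
  fixes b :: "nat \<Rightarrow> complex" and g :: "nat \<Rightarrow> nat \<Rightarrow> real \<Rightarrow> complex"
  assumes path: "\<And>i j. i < j \<Longrightarrow> j < 5 \<Longrightarrow> path (g i j)"
    and start: "\<And>i j. i < j \<Longrightarrow> j < 5 \<Longrightarrow> pathstart (g i j) = b i"
    and finish: "\<And>i j. i < j \<Longrightarrow> j < 5 \<Longrightarrow> pathfinish (g i j) = b j"
    and disj: "\<And>i j k l. i < j \<Longrightarrow> j < 5 \<Longrightarrow> k < l \<Longrightarrow> l < 5 \<Longrightarrow> {i, j} \<inter> {k, l} = {} \<Longrightarrow>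
           path_image (g i j) \<inter> path_image (g k l) = {}"
  shows False
proof -
  have ends: "b i \<in> path_image (g i j)" "b j \<in> path_image (g i j)" if "i < j" "j < 5" for i j
    using start[OF that] finish[OF that] pathstart_in_path_image pathfinish_in_path_image by metis+
  \<comment> \<open>Vertex \<open>k\<close> is an endpoint of an edge to some fourth vertex
    \<open>l\<close>, and that edge is disjoint from \<open>{i, j}\<close>.\<close>
  have avoid: "b k \<notin> path_image (g i j)" if ij: "i < j" "j < 5" and k: "k < 5" "k \<noteq> i" "k \<noteq> j" for i j k
  proof -
    have "card ({..<5} - {i, j, k}) = 2" using that by (subst card_Diff_subset) auto
    then have "{..<5} - {i, j, k} \<noteq> {}" by (metis card.empty zero_neq_numeral)
    then obtain l where l: "l < 5" "l \<noteq> i" "l \<noteq> j" "l \<noteq> k" by auto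
    show ?thesis
    proof (cases "k < l")
      case True
      then show ?thesis using disj[OF ij True l(1)] ends[OF True l(1)] k l by auto
    next
      case False
      then have lk: "l < k" using l by simp
      show ?thesis using disj[OF ij lk k(1)] ends[OF lk k(1)] k l by auto
    qed
  qed
  \<comment> \<open>Logarithms of \<open>b j - b i\<close>, chosen so that exchanging the indices
    changes them by exactly \<open>pi * \<i>\<close>, with a sign given by the order of the
    indices.\<close>
  define a where "a i j = (if i < j then Ln (b j - b i) else Ln (b i - b j) + pi * \<i>)" for i j
  have inj: "b i \<noteq> b j" if ij: "i < j" "j < 5" for i j
  proof -
    have "card ({..<5} - {i, j}) = 3" using that by (subst card_Diff_subset) auto
    then have "{..<5} - {i, j} \<noteq> {}" by (metis card.empty zero_neq_numeral)
    then obtain k where k: "k < 5" "k \<noteq> i" "k \<noteq> j" by auto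
    have "i < 5" "j \<noteq> i" using that by simp_all
    then show ?thesis
      using avoid[of i k j] avoid[of k i j] ends[of i k] ends[of k i] that k
      by (cases "i < k") auto
  qed
  have exp_a: "exp (a i j) = b j - b i" if "i < 5" "j < 5" "i \<noteq> j" for i j
    using that inj[of i j] inj[of j i] by (cases "i < j") (auto simp: a_def exp_add)
  \<comment> \<open>The integer measures how the curve from \<open>u\<close> to \<open>v\<close>
    winds around \<open>b x\<close>, compared with the fixed logarithms at its two ends.\<close>
  have "\<exists>m::int. x < 5 \<longrightarrow> u < v \<longrightarrow> v < 5 \<longrightarrow> x \<noteq> u \<longrightarrow> x \<noteq> v \<longrightarrow>
     log_increment (\<lambda>t. g u v t - b x) = a x v - a x u + 2 * pi * \<i> * m" for x u v
  proof (cases "x < 5 \<and> u < v \<and> v < 5 \<and> x \<noteq> u \<and> x \<noteq> v")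
    case True
    have "\<exists>m::int. log_increment (\<lambda>t. g u v t - b x) = a x v - a x u + 2 * pi * \<i> * m"
    proof (rule log_increment_int)
      show "continuous_on {0..1} (\<lambda>t. g u v t - b x)"
        using path[of u v] True unfolding path_def by (intro continuous_intros) auto
      show "g u v t - b x \<noteq> 0" if "t \<in> {0..1}" for t
        using avoid[of u v x] True that unfolding path_image_def by force
      show "exp (a x u) = g u v 0 - b x" "exp (a x v) = g u v 1 - b x"
        using exp_a[of x u] exp_a[of x v] True start[of u v] finish[of u v]
        by (simp_all add: pathstart_def pathfinish_def)
    qed
    then show ?thesis by blast
  qed auto
  then obtain k :: "nat \<Rightarrow> nat \<Rightarrow> nat \<Rightarrow> int" where
    k: "\<And>x u v. \<lbrakk>x < 5; u < v; v < 5; x \<noteq> u; x \<noteq> v\<rbrakk> \<Longrightarrow>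
      log_increment (\<lambda>t. g u v t - b x) = a x v - a x u + 2 * pi * \<i> * k x u v"
    by metis
  define s :: "nat \<Rightarrow> nat \<Rightarrow> int" where "s i j = (if i < j then -1 else 1)" for i j
  have s: "a i j - a j i = pi * \<i> * s i j" if "i \<noteq> j" for i j
    using that by (auto simp: a_def s_def)
  \<comment> \<open>The square relation for the disjoint edges \<open>uv\<close> and
    \<open>xy\<close>, divided by \<open>pi * \<i>\<close>.\<close>
  define R where "R u v x y = s x v + s u x + s v y + s y u
      + 2 * (k x u v + k v x y - k y u v - k u x y)" for u v x y
  have rel: "R u v x y = 0"
    if "u < v" "v < 5" "x < y" "y < 5" "{u, v} \<inter> {x, y} = {}" for u v x y
  proof -
    have ne: "x \<noteq> u" "x \<noteq> v" "y \<noteq> u" "y \<noteq> v" using that by auto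
    have gs: "g u v 0 = b u" "g u v 1 = b v" "g x y 0 = b x" "g x y 1 = b y"
      using start[of u v] finish[of u v] start[of x y] finish[of x y] that(1-4)
      unfolding pathstart_def pathfinish_def by blast+
    have lt: "u < 5" "x < 5" using that by simp_all
    have "log_increment (\<lambda>t. g u v t - b x) + log_increment (\<lambda>t. g x y t - b v)
       = log_increment (\<lambda>t. g u v t - b y) + log_increment (\<lambda>t. g x y t - b u)"
      using log_increment_square[OF path path disj, OF that(1,2) that(3,4) that] unfolding gs .
    moreover have "log_increment (\<lambda>t. g u v t - b x) = a x v - a x u + 2 * pi * \<i> * k x u v"
      "log_increment (\<lambda>t. g u v t - b y) = a y v - a y u + 2 * pi * \<i> * k y u v"
      "log_increment (\<lambda>t. g x y t - b v) = a v y - a v x + 2 * pi * \<i> * k v x y"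
      "log_increment (\<lambda>t. g x y t - b u) = a u y - a u x + 2 * pi * \<i> * k u x y"
      using that(1-4) ne ne[symmetric] lt by (blast intro: k)+
    ultimately have "(a x v - a v x) + (a u x - a x u) + (a v y - a y v) + (a y u - a u y)
       + 2 * pi * \<i> * (k x u v + k v x y - k y u v - k u x y) = 0"
      by (simp add: algebra_simps)
    then have "pi * \<i> * (s x v + s u x + s v y + s y u + 2 * (k x u v + k v x y - k y u v - k u x y)) = 0"
      unfolding s[OF ne(2)] s[OF ne(1)[symmetric]] s[OF ne(4)[symmetric]] s[OF ne(3)]
      by (simp add: algebra_simps)
    then have "(of_int (R u v x y) :: complex) = 0"
      unfolding R_def by (metis (no_types, lifting) mult_eq_0_iff complex_i_not_zero of_real_eq_0_iff pi_neq_zero)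
    then show ?thesis by (metis of_int_eq_0_iff)
  qed
  \<comment> \<open>The two occurrences of each \<open>k\<close> either cancel or have the same
    sign, which gives the coefficient 4 or -4. The left side is thus 2 modulo 4.\<close>
  have "4 * (k 2 0 1 + k 1 0 2 + k 2 1 3 + k 2 1 4 + k 2 3 4 + k 1 0 3 + k 3 1 2 + k 3 2 4
      + k 1 0 4 + k 4 2 3 - k 0 2 3 - k 4 0 1 - k 0 2 4 - k 0 3 4 - k 0 1 3 - k 4 0 2
      - k 0 1 4 - k 0 1 2 - k 4 0 3 - k 3 0 4) - 10 =
      R 0 1 2 3 + R 0 1 2 4 + R 0 1 3 4 + R 0 2 1 3 + R 0 2 1 4 +
      R 0 2 3 4 + R 0 3 1 2 + R 0 3 1 4 + R 0 3 2 4 + R 0 4 1 2 +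
      R 0 4 1 3 + R 0 4 2 3 + R 1 2 3 4 + R 1 3 2 4 + R 1 4 2 3"
    by (simp add: R_def s_def)
  also have "\<dots> = 0" by (simp add: rel)
  finally show False by presburger
qed

section \<open>Dense graphs contain subdivisions\<close>

definition rel_connected :: "('a \<times> 'a) set \<Rightarrow> 'a set \<Rightarrow> bool" where
  "rel_connected R U \<longleftrightarrow> (\<forall>x\<in>U. \<forall>y\<in>U. (x, y) \<in> (R \<inter> U \<times> U)\<^sup>*)"

lemma rel_connected_insert:
  assumes "rel_connected R U" "sym R" "u \<in> U" "(v, u) \<in> R"
  shows "rel_connected R (insert v U)"
proof -
  let ?S = "R \<inter> insert v U \<times> insert v U"
  have U: "(x, y) \<in> ?S\<^sup>*" if "x \<in> U" "y \<in> U" for x y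
    using assms(1) that rtrancl_mono[of "R \<inter> U \<times> U" ?S] unfolding rel_connected_def by blast
  have "(v, u) \<in> ?S" "(u, v) \<in> ?S" using assms by (auto dest: symD)
  then have "(x, u) \<in> ?S\<^sup>*" "(u, x) \<in> ?S\<^sup>*" if "x \<in> insert v U" for x
    using U that assms(3) by blast+
  then show ?thesis unfolding rel_connected_def by (meson rtrancl_trans)
qed

lemma card_rel_restrict:
  assumes "finite A" "finite B"
  shows "card (R \<inter> A \<times> B) = (\<Sum>x\<in>A. card (R `` {x} \<inter> B))"
proof -
  have "R \<inter> A \<times> B = Sigma A (\<lambda>x. R `` {x} \<inter> B)" by auto
  then show ?thesis using assms by simp
qed

lemma card_rel_restrict_remove:
  assumes "finite A" "v \<in> A" "sym R" "irrefl R"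
  shows "card (R \<inter> A \<times> A) = card (R \<inter> (A - {v}) \<times> (A - {v})) + 2 * card (R `` {v} \<inter> A)"
proof -
  let ?D = "R `` {v} \<inter> A"
  have "R \<inter> A \<times> A = (R \<inter> (A - {v}) \<times> (A - {v})) \<union> ({v} \<times> ?D \<union> ?D \<times> {v})"
    using assms by (auto dest: symD)
  moreover have "(R \<inter> (A - {v}) \<times> (A - {v})) \<inter> ({v} \<times> ?D \<union> ?D \<times> {v}) = {}"
    by auto
  moreover have "({v} \<times> ?D) \<inter> (?D \<times> {v}) = {}"
    using assms(4) by (auto simp: irrefl_def)
  ultimately show ?thesis
    using assms(1) by (simp add: card_Un_disjoint card_cartesian_product)
qed

text \<open>Mader's contraction argument. The number \<open>card (R \<inter> (V - U) \<times> (V - U)) + 2 * card (nb U)\<close>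
  counts (twice) the edges left after contracting \<open>U\<close>. For a maximal connected \<open>U\<close> whose
  contraction preserves the density, adding a neighbour \<open>v\<close> of \<open>U\<close> destroys \<open>1 + d\<close> edges,
  where \<open>d\<close> is the degree of \<open>v\<close> inside the neighbourhood of \<open>U\<close>.\<close>
lemma dense_neighbourhood:
  fixes R :: "('a \<times> 'a) set"
  assumes "finite V" "V \<noteq> {}" "sym R" "irrefl R" "K \<ge> 1" "2 * K * card V \<le> card (R \<inter> V \<times> V)"
  shows "\<exists>U N. U \<subseteq> V \<and> N \<subseteq> V - U \<and> N \<noteq> {} \<and> rel_connected R U \<and>
           (\<forall>x\<in>N. \<exists>u\<in>U. (x, u) \<in> R) \<and> K * card N \<le> card (R \<inter> N \<times> N)"
  using assms
proof (induction "card V" arbitrary: V rule: less_induct)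
  case less
  define nb where "nb U = {x \<in> V - U. \<exists>u\<in>U. (x, u) \<in> R}" for U
  \<comment> \<open>Contracting \<open>U\<close> leaves \<open>card V - card U + 1\<close> vertices.
    The inequality says that the contracted graph still has density \<open>2 * K\<close>, written
    additively to avoid subtraction of naturals.\<close>
  define good where "good U \<longleftrightarrow> U \<subseteq> V \<and> U \<noteq> {} \<and> rel_connected R U \<and>
     2 * K * (card V + 1) \<le> card (R \<inter> (V - U) \<times> (V - U)) + 2 * card (nb U) + 2 * K * card U" for U
  note fin = less.prems(1)
  obtain v where v: "v \<in> V" using less.prems by auto
  have "nb {v} = R `` {v} \<inter> V"
    using less.prems(3,4) unfolding nb_def by (auto dest: symD simp: irrefl_def)
  then have "good {v}"
    using card_rel_restrict_remove[OF fin v less.prems(3,4)] less.prems(6) v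
    unfolding good_def by (auto simp: rel_connected_def)
  moreover have "card U \<le> card V" if "good U" for U
    using that fin by (auto simp: good_def intro: card_mono)
  ultimately obtain U where U: "good U" and max: "\<And>U'. good U' \<Longrightarrow> card U' \<le> card U"
    using ex_has_greatest_nat[of good "{v}" card "Suc (card V)"] by (metis less_Suc_eq_le)
  have finU: "finite U" and UV: "U \<subseteq> V" using U fin by (auto simp: good_def intro: finite_subset)
  have cardV: "card V = card U + card (V - U)"
    using UV finU fin by (simp add: card_Diff_subset card_mono)
  show ?case
  proof (cases "nb U = {}")
    \<comment> \<open>Without neighbours, \<open>U\<close> contracts to an isolated vertex, so the
      smaller graph on \<open>V - U\<close> is itself dense and the induction hypothesis
      applies.\<close>
    case True
    then have *: "2 * K * (card (V - U) + 1) \<le> card (R \<inter> (V - U) \<times> (V - U))"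
      using U unfolding good_def cardV by (simp add: algebra_simps)
    then have "V - U \<noteq> {}" using less.prems(5) by (metis card.empty Sigma_empty1 inf_bot_right
      le_zero_eq mult_eq_0_iff not_one_le_zero zero_neq_numeral add_is_0)
    moreover have "card (V - U) < card V"
      using U UV fin by (intro psubset_card_mono) (auto simp: good_def)
    moreover have "2 * K * card (V - U) \<le> card (R \<inter> (V - U) \<times> (V - U))"
      using * by (simp add: algebra_simps)
    ultimately obtain U' N where "U' \<subseteq> V - U" "N \<subseteq> V - U - U'" "N \<noteq> {}" "rel_connected R U'"
      "\<forall>x\<in>N. \<exists>u\<in>U'. (x, u) \<in> R" "K * card N \<le> card (R \<inter> N \<times> N)"
      using less.hyps[of "V - U"] less.prems(3-5) fin by auto
    then show ?thesis by blast
  next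
    case False
    define N where "N = nb U"
    have N: "N \<subseteq> V - U" "finite N" using fin by (auto simp: N_def nb_def)
    \<comment> \<open>By maximality, adding \<open>x\<close> to \<open>U\<close> destroys the
      density: the loss of \<open>1 + d\<close> edges exceeds the \<open>K\<close> edges that one
      vertex accounts for. Hence \<open>K < 1 + d\<close>, that is \<open>K \<le> d\<close>.\<close>
    have deg: "K \<le> card (R `` {x} \<inter> N)" if x: "x \<in> N" for x
    proof -
      obtain u where u: "u \<in> U" "(x, u) \<in> R" "x \<in> V - U" using x by (auto simp: N_def nb_def)
      let ?U = "insert x U" and ?W = "V - U"
      have "\<not> good ?U" using max[of ?U] finU u by auto
      moreover have "rel_connected R ?U"
        using U u less.prems(3) by (auto simp: good_def intro: rel_connected_insert)
      moreover have "V - ?U = ?W - {x}" by auto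
      ultimately have lt: "card (R \<inter> (?W - {x}) \<times> (?W - {x})) + 2 * card (nb ?U) + 2 * K * (card U + 1)
           < 2 * K * (card V + 1)"
        using UV u finU unfolding good_def by auto
      have "nb ?U = (N - {x}) \<union> (R `` {x} \<inter> ?W - N)"
        using u less.prems(3,4) unfolding nb_def N_def by (auto dest: symD simp: irrefl_def)
      moreover have "card ((N - {x}) \<union> (R `` {x} \<inter> ?W - N)) = card (N - {x}) + card (R `` {x} \<inter> ?W - N)"
        using fin N by (intro card_Un_disjoint) auto
      moreover have "card (R `` {x} \<inter> ?W) = card (R `` {x} \<inter> ?W - N) + card (R `` {x} \<inter> N)"
      proof -
        have "R `` {x} \<inter> ?W = (R `` {x} \<inter> ?W - N) \<union> (R `` {x} \<inter> N)" using N by auto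
        then show ?thesis using fin N by (metis card_Un_disjoint Diff_disjoint finite_Diff finite_Int
          Int_assoc Int_commute inf_bot_right)
      qed
      moreover have "card (N - {x}) + 1 = card N" using card_Suc_Diff1[OF N(2) x] by simp
      moreover have "card (R \<inter> ?W \<times> ?W) = card (R \<inter> (?W - {x}) \<times> (?W - {x})) + 2 * card (R `` {x} \<inter> ?W)"
        using card_rel_restrict_remove[of ?W x R] fin u less.prems(3,4) by auto
      moreover have "2 * K * (card V + 1) \<le> card (R \<inter> ?W \<times> ?W) + 2 * card N + 2 * K * card U"
        using U by (simp add: good_def N_def)
      ultimately show ?thesis using lt by (simp add: algebra_simps)
    qed
    have "K * card N \<le> card (R \<inter> N \<times> N)"
      unfolding card_rel_restrict[OF N(2) N(2)]
      using sum_mono[of N "\<lambda>_. K", OF deg] by (simp add: mult.commute)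
    then have "U \<subseteq> V \<and> N \<subseteq> V - U \<and> N \<noteq> {} \<and> rel_connected R U \<and>
           (\<forall>x\<in>N. \<exists>u\<in>U. (x, u) \<in> R) \<and> K * card N \<le> card (R \<inter> N \<times> N)"
      using UV N False U by (auto simp: N_def nb_def good_def)
    then show ?thesis by blast
  qed
qed

text \<open>Iterate \<open>dense_neighbourhood\<close> inside the neighbourhood found last; every
  round halves the density, hence the factor \<open>2 ^ card I\<close>. The first set avoids
  \<open>N0\<close> and the later ones lie in \<open>N0\<close>, so they are disjoint, and the final
  \<open>N\<close> is adjacent to all of them.\<close>

lemma dense_common_neighbourhood:
  fixes R :: "('a \<times> 'a) set" and I :: "'i set"
  assumes "finite I" "finite V" "V \<noteq> {}" "sym R" "irrefl R" "K \<ge> 1"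
    "2 ^ card I * K * card V \<le> card (R \<inter> V \<times> V)"
  shows "\<exists>U N. N \<subseteq> V \<and> N \<noteq> {} \<and> K * card N \<le> card (R \<inter> N \<times> N) \<and>
           (\<forall>i\<in>I. U i \<subseteq> V - N \<and> rel_connected R (U i) \<and> (\<forall>x\<in>N. \<exists>u\<in>U i. (x, u) \<in> R)) \<and>
           disjoint_family_on U I"
  using assms
proof (induction I arbitrary: V rule: finite_induct)
  case empty
  then show ?case by (auto simp: disjoint_family_on_def)
next
  case (insert i I)
  have "2 * (2 ^ card I * K) * card V \<le> card (R \<inter> V \<times> V)" "2 ^ card I * K \<ge> 1"
    using insert by auto
  then obtain U0 N0 where 0: "U0 \<subseteq> V" "N0 \<subseteq> V - U0" "N0 \<noteq> {}" "rel_connected R U0"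
      "\<forall>x\<in>N0. \<exists>u\<in>U0. (x, u) \<in> R" "2 ^ card I * K * card N0 \<le> card (R \<inter> N0 \<times> N0)"
      and "N0 \<subseteq> V"
    using dense_neighbourhood[of V R "2 ^ card I * K"] insert.prems
    by (metis Diff_subset subset_trans)
  have "finite N0" using 0 insert.prems by (meson finite_Diff finite_subset)
  then obtain U N where UN: "N \<subseteq> N0" "N \<noteq> {}" "K * card N \<le> card (R \<inter> N \<times> N)"
      "\<forall>i\<in>I. U i \<subseteq> N0 - N \<and> rel_connected R (U i) \<and> (\<forall>x\<in>N. \<exists>u\<in>U i. (x, u) \<in> R)"
      "disjoint_family_on U I"
    using insert.IH[of N0] 0 insert.prems by metis
  let ?U = "U(i := U0)"
  have "disjoint_family_on ?U (insert i I)"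
    using UN(4,5) 0 insert.hyps unfolding disjoint_family_on_def by (auto; blast)
  moreover have "?U j \<subseteq> V - N \<and> rel_connected R (?U j) \<and> (\<forall>x\<in>N. \<exists>u\<in>?U j. (x, u) \<in> R)"
    if "j \<in> insert i I" for j
  proof (cases "j = i")
    case False
    then have "j \<in> I" using that by simp
    then show ?thesis using UN(1,4) \<open>N0 \<subseteq> V\<close> False by (auto; blast)
  qed (use UN(1) 0 in auto)
  ultimately show ?case using UN(1-3) 0 by (intro exI[of _ ?U] exI[of _ N]) blast
qed

text \<open>Without loops every degree inside \<open>N\<close> is below \<open>card N\<close>, while
  the average degree is at least \<open>K\<close>.\<close>

lemma card_gt_of_dense:
  assumes "finite N" "N \<noteq> {}" "irrefl R" "K * card N \<le> card (R \<inter> N \<times> N)"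
  shows "K < card N"
proof -
  have "card (R `` {x} \<inter> N) < card N" if "x \<in> N" for x
    using assms that by (intro psubset_card_mono) (auto simp: irrefl_def)
  then have "card (R \<inter> N \<times> N) < card N * card N"
    unfolding card_rel_restrict[OF assms(1,1)]
    using sum_strict_mono[of N "\<lambda>x. card (R `` {x} \<inter> N)" "\<lambda>_. card N"] assms by simp
  then show ?thesis using assms(4) by (metis le_less_trans mult_less_cancel2)
qed

section \<open>A crossing lemma for disjoint edges\<close>

lemma is_drawing_inj: "is_drawing V E p \<gamma> \<Longrightarrow> x \<in> V \<Longrightarrow> y \<in> V \<Longrightarrow> p x = p y \<Longrightarrow> x = y"
  unfolding is_drawing_def by (meson inj_onD)

lemma is_drawing_edge:
  assumes "is_drawing V E p \<gamma>" "e \<in> E"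
  shows "path (\<gamma> e)" "pathstart (\<gamma> e) = p (fst e)" "pathfinish (\<gamma> e) = p (snd e)"
    "path_image (\<gamma> e) \<inter> p ` V \<subseteq> {p (fst e), p (snd e)}"
proof -
  obtain u v where e: "e = (u, v)" by (cases e)
  have "arc (\<gamma> (u, v)) \<and> pathstart (\<gamma> (u, v)) = p u \<and> pathfinish (\<gamma> (u, v)) = p v \<and>
        path_image (\<gamma> (u, v)) \<inter> p ` V \<subseteq> {p u, p v}"
    using assms unfolding is_drawing_def e by blast
  then show "path (\<gamma> e)" "pathstart (\<gamma> e) = p (fst e)" "pathfinish (\<gamma> e) = p (snd e)"
    "path_image (\<gamma> e) \<inter> p ` V \<subseteq> {p (fst e), p (snd e)}"
    by (simp_all add: e arc_imp_path)
qed

lemma is_drawing_vertex_on_edge: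
  assumes "is_drawing V E p \<gamma>" "E \<subseteq> V \<times> V" "e \<in> E" "x \<in> V" "p x \<in> path_image (\<gamma> e)"
  shows "x = fst e \<or> x = snd e"
proof -
  have "p x = p (fst e) \<or> p x = p (snd e)"
    using is_drawing_edge(4)[OF assms(1,3)] assms(4,5) by blast
  moreover have "fst e \<in> V" "snd e \<in> V" using assms(2,3) by auto
  ultimately show ?thesis using is_drawing_inj[OF assms(1)] assms(4) by metis
qed

text \<open>Disjointness of the edges serves twice: the parity argument detects crossings of
  disjoint edges, and four distinct endpoints make the sampling polynomial affine in each
  variable.\<close>

definition independent_crossing :: "('a \<times> 'a \<Rightarrow> real \<Rightarrow> complex) \<Rightarrow> 'a \<times> 'a \<Rightarrow> 'a \<times> 'a \<Rightarrow> bool" where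
  "independent_crossing \<gamma> e e' \<longleftrightarrow> {fst e, snd e} \<inter> {fst e', snd e'} = {} \<and>
     path_image (\<gamma> e) \<inter> path_image (\<gamma> e') \<noteq> {}"

definition drawn_part ::
  "('a \<Rightarrow> complex) \<Rightarrow> ('a \<times> 'a \<Rightarrow> real \<Rightarrow> complex) \<Rightarrow> ('a \<times> 'a) set \<Rightarrow> 'a set \<Rightarrow> complex set" where
  "drawn_part p \<gamma> F S = p ` S \<union> (\<Union>e\<in>F \<inter> S \<times> S. path_image (\<gamma> e))"

text \<open>Two vertices differ by injectivity, an edge passes through no vertex other than its
  ends, and a common point of two edges would be an independent crossing.\<close>

lemma drawn_part_disjoint:
  assumes dr: "is_drawing V E p \<gamma>" and E: "E \<subseteq> V \<times> V" and F: "F \<subseteq> E"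
    and S: "S \<subseteq> V" "S' \<subseteq> V" "S \<inter> S' = {}"
    and no: "\<And>e e'. e \<in> F \<Longrightarrow> e' \<in> F \<Longrightarrow> \<not> independent_crossing \<gamma> e e'"
  shows "drawn_part p \<gamma> F S \<inter> drawn_part p \<gamma> F S' = {}"
proof -
  have 1: "p x \<noteq> p y" if "x \<in> S" "y \<in> S'" for x y
    using that S is_drawing_inj[OF dr, of x y] by blast
  have 2: "p x \<notin> path_image (\<gamma> e)" if "x \<in> V" "e \<in> F" "x \<notin> {fst e, snd e}" for x e
    using is_drawing_vertex_on_edge[OF dr E, of e x] that F by blast
  have 3: "path_image (\<gamma> e) \<inter> path_image (\<gamma> e') = {}" if "e \<in> F \<inter> S \<times> S" "e' \<in> F \<inter> S' \<times> S'" for e e'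
  proof -
    have "{fst e, snd e} \<inter> {fst e', snd e'} = {}" using that S by auto
    then show ?thesis using no[of e e'] that unfolding independent_crossing_def by blast
  qed
  have 4: "p x \<notin> path_image (\<gamma> e)" if "x \<in> A" "e \<in> F \<inter> B \<times> B" "A \<subseteq> V" "A \<inter> B = {}" for x e A B
    using that by (intro 2) auto
  have 5: "S' \<inter> S = {}" using S by blast
  show ?thesis
    unfolding drawn_part_def
    using 1 3 4[OF _ _ S(1) S(3)] 4[OF _ _ S(2) 5] by (fastforce simp: disjoint_iff)
qed

lemma drawn_part_path_component:
  assumes dr: "is_drawing V E p \<gamma>" and F: "F \<subseteq> E"
    and conn: "rel_connected (F \<union> F\<inverse>) S" and xy: "x \<in> S" "y \<in> S"
  shows "path_component (drawn_part p \<gamma> F S) (p x) (p y)"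
proof -
  let ?A = "drawn_part p \<gamma> F S"
  have edge: "path_component ?A (p u) (p v)" if "(u, v) \<in> F \<inter> S \<times> S" for u v
    unfolding path_component_def
    using is_drawing_edge[OF dr, of "(u, v)"] that F
    by (intro exI[of _ "\<gamma> (u, v)"]) (auto simp: drawn_part_def)
  have "(x, y) \<in> ((F \<union> F\<inverse>) \<inter> S \<times> S)\<^sup>*"
    using conn xy by (simp add: rel_connected_def)
  then show ?thesis
  proof (induction rule: rtrancl_induct)
    case base
    then show ?case using xy by (intro path_component_refl) (auto simp: drawn_part_def)
  next
    case (step y z)
    then have "path_component ?A (p y) (p z)"
      using edge[of y z] edge[of z y] path_component_sym by blast
    then show ?case using step.IH path_component_trans by blast
  qed
qed

text \<open>Too many edges yield five branch vertices joined pairwise through ten disjoint connected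
  sets. The drawing of this subdivision contains a drawing of \<open>K5\<close> without crossings of
  disjoint edges, which is impossible.\<close>

lemma card_no_independent_crossing:
  assumes dr: "is_drawing V E p \<gamma>" and E: "E \<subseteq> {(u, v). u \<in> V \<and> v \<in> V \<and> u < v}"
    and T: "finite T" "T \<noteq> {}" "T \<subseteq> V" and F: "F \<subseteq> E" "F \<subseteq> T \<times> T"
    and no: "\<And>e e'. e \<in> F \<Longrightarrow> e' \<in> F \<Longrightarrow> \<not> independent_crossing \<gamma> e e'"
  shows "card F \<le> 2048 * card T"
proof (rule ccontr)
  assume gt: "\<not> card F \<le> 2048 * card T"
  define R where "R = F \<union> F\<inverse>"
  have EV: "E \<subseteq> V \<times> V" using E by auto
  have finF: "finite F" using F(2) T(1) by (meson finite_SigmaI finite_subset)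
  have lt: "u < v" if "(u, v) \<in> F" for u v using that F(1) E by blast
  then have "(v, u) \<notin> F" if "(u, v) \<in> F" for u v using that less_asym by blast
  then have "F \<inter> F\<inverse> = {}" by auto
  then have "card R = 2 * card F"
    unfolding R_def using finF by (simp add: card_Un_disjoint)
  moreover have "R \<inter> T \<times> T = R" using F(2) by (auto simp: R_def)
  moreover have sym: "sym R" by (auto simp: R_def sym_def)
  moreover have irr: "irrefl R" using lt by (auto simp: R_def irrefl_def)
  \<comment> \<open>One connecting set for each of the ten edges of \<open>K5\<close>. The constant
    2048 comes from \<open>2 * 2048 = 2 ^ 10 * 4\<close>, each edge being two pairs of
    \<open>R\<close>.\<close>
  moreover define I where "I = {(0,1), (0,2), (0,3), (0,4), (1,2), (1,3), (1,4), (2,3), (2,4), (3::nat,4::nat)}"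
  have "card I = 10" by (simp add: I_def)
  ultimately have "2 ^ card I * 4 * card T \<le> card (R \<inter> T \<times> T)"
    using gt by simp
  moreover have "finite I" by (simp add: I_def)
  ultimately have "\<exists>U N. N \<subseteq> T \<and> N \<noteq> {} \<and> 4 * card N \<le> card (R \<inter> N \<times> N) \<and>
      (\<forall>i\<in>I. U i \<subseteq> T - N \<and> rel_connected R (U i) \<and> (\<forall>x\<in>N. \<exists>u\<in>U i. (x, u) \<in> R)) \<and>
      disjoint_family_on U I"
    by (intro dense_common_neighbourhood T sym irr) simp_all
  then obtain U N where N: "N \<subseteq> T" "N \<noteq> {}" "4 * card N \<le> card (R \<inter> N \<times> N)"
    and "\<forall>i\<in>I. U i \<subseteq> T - N \<and> rel_connected R (U i) \<and> (\<forall>x\<in>N. \<exists>u\<in>U i. (x, u) \<in> R)"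
    and dU: "disjoint_family_on U I"
    by blast
  then have U: "U i \<subseteq> T - N" "rel_connected R (U i)" "\<And>x. x \<in> N \<Longrightarrow> \<exists>u\<in>U i. (x, u) \<in> R"
    if "i \<in> I" for i
    using that by blast+
  have finN: "finite N" using N T finite_subset by blast
  \<comment> \<open>Density 4 is what provides five branch vertices.\<close>
  have "4 < card N" by (rule card_gt_of_dense[OF finN N(2) irr N(3)])
  moreover obtain b where "bij_betw b {0..<card N} N"
    using ex_bij_betw_nat_finite[OF finN] by blast
  ultimately have binj: "inj_on b {..<5}" and "b ` {..<5} \<subseteq> N"
    unfolding bij_betw_def by (auto intro: inj_on_subset)
  then have bN: "b i \<in> N" if "i < 5" for i using that by blast
  have memI: "(i, j) \<in> I" if "i < j" "j < 5" for i j
  proof -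
    have "j \<in> {0,1,2,3,4}" "i \<in> {0,1,2,3,4}" using that by auto
    then show ?thesis using that by (auto simp: I_def)
  qed
  \<comment> \<open>Both branch vertices have neighbours in the connected set
    \<open>U (i, j)\<close>, so \<open>S i j\<close> is connected. Two such sets for disjoint index
    pairs do not meet.\<close>
  define S where "S i j = insert (b i) (insert (b j) (U (i, j)))" for i j
  have SV: "S i j \<subseteq> V" if "i < j" "j < 5" for i j
  proof -
    have "b i \<in> N" "b j \<in> N" using bN that by simp_all
    then show ?thesis using U(1)[OF memI[OF that]] N(1) T(3) unfolding S_def by blast
  qed
  have Sdisj: "S i j \<inter> S k l = {}"
    if "i < j" "j < 5" "k < l" "l < 5" "{i, j} \<inter> {k, l} = {}" for i j k l
  proof -
    have "(i, j) \<noteq> (k, l)" using that by auto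
    then have "U (i, j) \<inter> U (k, l) = {}"
      using dU memI[OF that(1,2)] memI[OF that(3,4)] unfolding disjoint_family_on_def by metis
    moreover have lt: "i < 5" "j < 5" "k < 5" "l < 5" using that by simp_all
    then have "b i \<noteq> b k" "b i \<noteq> b l" "b j \<noteq> b k" "b j \<noteq> b l"
      using that(5) by (simp_all add: inj_on_eq_iff[OF binj])
    then have "{b i, b j} \<inter> {b k, b l} = {}" by simp
    moreover have "{b i, b j} \<subseteq> N" "{b k, b l} \<subseteq> N"
      using bN lt by simp_all
    moreover have "U (i, j) \<inter> N = {}" "U (k, l) \<inter> N = {}"
      using U(1)[OF memI[OF that(1,2)]] U(1)[OF memI[OF that(3,4)]] by blast+
    ultimately show ?thesis unfolding S_def by blast
  qed
  have "\<exists>g. i < j \<longrightarrow> j < 5 \<longrightarrow> path g \<and> path_image g \<subseteq> drawn_part p \<gamma> F (S i j) \<and>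
      pathstart g = p (b i) \<and> pathfinish g = p (b j)" for i j
  proof (cases "i < j \<and> j < 5")
    case True
    then have bb: "b i \<in> N" "b j \<in> N" using bN[of i] bN[of j] by auto
    have ij: "(i, j) \<in> I" using memI True by blast
    have "rel_connected R (insert (b j) (U (i, j)))"
      using U(3)[OF ij bb(2)] rel_connected_insert[OF U(2)[OF ij] sym] by blast
    then have "rel_connected R (S i j)"
      unfolding S_def using U(3)[OF ij bb(1)] rel_connected_insert[OF _ sym] by blast
    then have "path_component (drawn_part p \<gamma> F (S i j)) (p (b i)) (p (b j))"
      unfolding R_def by (rule drawn_part_path_component[OF dr F(1)]) (auto simp: S_def)
    then show ?thesis unfolding path_component_def by blast
  qed auto
  then obtain g where g: "\<And>i j. i < j \<Longrightarrow> j < 5 \<Longrightarrow> path (g i j) \<and>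
      path_image (g i j) \<subseteq> drawn_part p \<gamma> F (S i j) \<and>
      pathstart (g i j) = p (b i) \<and> pathfinish (g i j) = p (b j)"
    by metis
  show False
  proof (rule K5_independent_crossing[of g "\<lambda>i. p (b i)"])
    fix i j k l :: nat
    assume ijkl: "i < j" "j < 5" "k < l" "l < 5" "{i, j} \<inter> {k, l} = {}"
    have "drawn_part p \<gamma> F (S i j) \<inter> drawn_part p \<gamma> F (S k l) = {}"
      using drawn_part_disjoint[OF dr EV F(1) SV SV Sdisj no] ijkl by blast
    then show "path_image (g i j) \<inter> path_image (g k l) = {}"
      using g[OF ijkl(1,2)] g[OF ijkl(3,4)] by blast
  qed (use g in auto)
qed

section \<open>From one crossing to many\<close>

definition crossing_pairs :: "('a \<times> 'a \<Rightarrow> real \<Rightarrow> complex) \<Rightarrow> ('a \<times> 'a) set \<Rightarrow> (('a \<times> 'a) \<times> 'a \<times> 'a) set" where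
  "crossing_pairs \<gamma> F = {(e, e') \<in> F \<times> F. independent_crossing \<gamma> e e'}"

lemma finite_crossing_pairs: "finite F \<Longrightarrow> finite (crossing_pairs \<gamma> F)"
  unfolding crossing_pairs_def by (rule finite_subset[of _ "F \<times> F"]) auto

text \<open>Deleting one edge of a crossing pair costs one edge and removes at least one pair; once
  no pair is left, the bound for crossing-free sets applies.\<close>

lemma card_le_crossing_pairs:
  assumes dr: "is_drawing V E p \<gamma>" and E: "E \<subseteq> {(u, v). u \<in> V \<and> v \<in> V \<and> u < v}"
    and T: "finite T" "T \<subseteq> V" and F: "F \<subseteq> E" "F \<subseteq> T \<times> T"
  shows "card F \<le> 2048 * card T + card (crossing_pairs \<gamma> F)"
  using F
proof (induction "card F" arbitrary: F rule: less_induct)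
  case less
  have fin: "finite F" using less.prems T by (meson finite_SigmaI finite_subset)
  show ?case
  proof (cases "\<exists>e\<in>F. \<exists>e'\<in>F. independent_crossing \<gamma> e e'")
    case True
    then obtain e e' where e: "e \<in> F" "e' \<in> F" "independent_crossing \<gamma> e e'" by blast
    have "card (F - {e}) \<le> 2048 * card T + card (crossing_pairs \<gamma> (F - {e}))"
      using less.hyps[OF card_Diff1_less[OF fin e(1)]] less.prems by blast
    moreover have "card (crossing_pairs \<gamma> (F - {e})) < card (crossing_pairs \<gamma> F)"
      using e by (intro psubset_card_mono finite_crossing_pairs fin) (auto simp: crossing_pairs_def)
    moreover have "card F = card (F - {e}) + 1"
      using e fin by (metis card.remove Suc_eq_plus1)
    ultimately show ?thesis by linarith
  next
    case False
    show ?thesis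
    proof (cases "T = {}")
      case True
      then show ?thesis using less.prems by auto
    next
      case ne: False
      have "card F \<le> 2048 * card T"
        using False less.prems by (intro card_no_independent_crossing[OF dr E T(1) ne T(2)]) blast+
      then show ?thesis by simp
    qed
  qed
qed

text \<open>The value at a point of the cube is a convex combination of the values at its corners.
  This replaces taking the expectation over a random subset.\<close>

lemma multiaffine_nonneg:
  fixes f :: "('a \<Rightarrow> real) \<Rightarrow> real"
  assumes "finite V"
    and affine: "\<And>x i. i \<in> V \<Longrightarrow> f x = (1 - x i) * f (x(i := 0)) + x i * f (x(i := 1))"
    and vertex: "\<And>x. x ` V \<subseteq> {0, 1} \<Longrightarrow> 0 \<le> f x"
    and x: "x ` V \<subseteq> {0..1}"
  shows "0 \<le> f x"
proof -
  \<comment> \<open>\<open>A\<close> collects the coordinates that may be fractional; the induction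
    rounds them one at a time.\<close>
  have "0 \<le> f x" if "finite A" "A \<subseteq> V" "x ` A \<subseteq> {0..1}" "x ` (V - A) \<subseteq> {0, 1}" for A x
    using that
  proof (induction A arbitrary: x rule: finite_induct)
    case empty
    then show ?case using vertex by simp
  next
    case (insert i A)
    have upd: "0 \<le> f (x(i := c))" if c: "c \<in> {0, 1}" for c
      using insert.prems insert.hyps c by (intro insert.IH) auto
    have "0 \<le> x i" "x i \<le> 1" "i \<in> V" using insert.prems by auto
    then show ?case
      using affine[of i x] upd[of 0] upd[of 1] by simp
  qed
  then show ?thesis using assms by blast
qed

text \<open>The crossing lemma in unoptimised form. The difference of the two sides is an affine
  function of the sampling probability of each vertex, because independent edges have four
  distinct endpoints; so it suffices to consider probabilities 0 and 1.\<close>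
lemma crossing_pairs_sampling:
  fixes q :: real
  assumes dr: "is_drawing V E p \<gamma>" and E: "E \<subseteq> {(u, v). u \<in> V \<and> v \<in> V \<and> u < v}"
    and T: "finite T" "T \<subseteq> V" and F: "F \<subseteq> E" "F \<subseteq> T \<times> T" and q: "0 \<le> q" "q \<le> 1"
  shows "q ^ 2 * card F \<le> q ^ 4 * card (crossing_pairs \<gamma> F) + 2048 * (q * card T)"
proof -
  have finF: "finite F" using F(2) T(1) by (meson finite_SigmaI finite_subset)
  define f :: "(nat \<Rightarrow> real) \<Rightarrow> real" where
    "f x = (\<Sum>(e, e')\<in>crossing_pairs \<gamma> F. x (fst e) * x (snd e) * x (fst e') * x (snd e'))
       + 2048 * (\<Sum>u\<in>T. x u) - (\<Sum>e\<in>F. x (fst e) * x (snd e))" for x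
  have "0 \<le> f (\<lambda>_. q)"
  proof (rule multiaffine_nonneg[OF T(1), of f])
    fix x :: "nat \<Rightarrow> real" and i
    let ?x0 = "x(i := 0)" and ?x1 = "x(i := 1)"
    have 1: "(\<Sum>(e, e')\<in>crossing_pairs \<gamma> F. x (fst e) * x (snd e) * x (fst e') * x (snd e'))
       = (\<Sum>(e, e')\<in>crossing_pairs \<gamma> F.
           (1 - x i) * (?x0 (fst e) * ?x0 (snd e) * ?x0 (fst e') * ?x0 (snd e'))
           + x i * (?x1 (fst e) * ?x1 (snd e) * ?x1 (fst e') * ?x1 (snd e')))"
    proof (intro sum.cong refl, clarify)
      fix a b c d assume "((a, b), c, d) \<in> crossing_pairs \<gamma> F"
      then have "a < b" "c < d" "a \<noteq> c" "a \<noteq> d" "b \<noteq> c" "b \<noteq> d"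
        using F(1) E by (auto simp: crossing_pairs_def independent_crossing_def)
      then show "x (fst (a, b)) * x (snd (a, b)) * x (fst (c, d)) * x (snd (c, d)) =
          (1 - x i) * (?x0 (fst (a, b)) * ?x0 (snd (a, b)) * ?x0 (fst (c, d)) * ?x0 (snd (c, d)))
           + x i * (?x1 (fst (a, b)) * ?x1 (snd (a, b)) * ?x1 (fst (c, d)) * ?x1 (snd (c, d)))"
        by (auto simp: algebra_simps)
    qed
    have 2: "(\<Sum>u\<in>T. x u) = (\<Sum>u\<in>T. (1 - x i) * ?x0 u + x i * ?x1 u)"
      by (intro sum.cong) (auto simp: algebra_simps)
    have 3: "(\<Sum>e\<in>F. x (fst e) * x (snd e))
       = (\<Sum>e\<in>F. (1 - x i) * (?x0 (fst e) * ?x0 (snd e)) + x i * (?x1 (fst e) * ?x1 (snd e)))"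
    proof (intro sum.cong refl)
      fix e assume "e \<in> F"
      then have "fst e \<noteq> snd e" using F(1) E by fastforce
      then show "x (fst e) * x (snd e)
        = (1 - x i) * (?x0 (fst e) * ?x0 (snd e)) + x i * (?x1 (fst e) * ?x1 (snd e))"
        by (auto simp: algebra_simps)
    qed
    show "f x = (1 - x i) * f ?x0 + x i * f ?x1"
      unfolding f_def 1 2 3
      by (simp only: split_def sum.distrib sum_distrib_left[symmetric]) (simp only: algebra_simps)
  next
    fix x :: "nat \<Rightarrow> real"
    assume x: "x ` T \<subseteq> {0, 1}"
    \<comment> \<open>A corner of the cube is a subset \<open>T'\<close> of \<open>T\<close>, and
      there \<open>f x\<close> is the slack in \<open>card_le_crossing_pairs\<close> for the
      subgraph induced by \<open>T'\<close>.\<close>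
    define T' where "T' = {u \<in> T. x u = 1}"
    have x01: "x u = of_bool (u \<in> T')" if "u \<in> T" for u using x that by (auto simp: T'_def)
    let ?F = "F \<inter> T' \<times> T'"
    have sub: "crossing_pairs \<gamma> F \<inter> (T' \<times> T') \<times> (T' \<times> T') = crossing_pairs \<gamma> ?F"
      by (auto simp: crossing_pairs_def)
    have "(\<Sum>(e, e')\<in>crossing_pairs \<gamma> F. x (fst e) * x (snd e) * x (fst e') * x (snd e'))
        = (\<Sum>z\<in>crossing_pairs \<gamma> F. of_bool (z \<in> (T' \<times> T') \<times> (T' \<times> T')))"
      using F(2) by (intro sum.cong) (auto simp: crossing_pairs_def x01 subset_iff)
    also have "\<dots> = card (crossing_pairs \<gamma> ?F)"
      using finite_crossing_pairs[OF finF] by (simp add: sub)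
    finally have 1: "(\<Sum>(e, e')\<in>crossing_pairs \<gamma> F. x (fst e) * x (snd e) * x (fst e') * x (snd e'))
        = card (crossing_pairs \<gamma> ?F)" .
    have "(\<Sum>u\<in>T. x u) = (\<Sum>u\<in>T. of_bool (u \<in> T'))" by (intro sum.cong) (auto simp: x01)
    also have "\<dots> = card (T \<inter> T')" using T(1) by simp
    finally have 2: "(\<Sum>u\<in>T. x u) = card T'" by (simp add: T'_def Int_def)
    have "(\<Sum>e\<in>F. x (fst e) * x (snd e)) = (\<Sum>e\<in>F. of_bool (e \<in> T' \<times> T'))"
      using F(2) by (intro sum.cong) (auto simp: x01 subset_iff)
    also have "\<dots> = card ?F" using finF by simp
    finally have 3: "(\<Sum>e\<in>F. x (fst e) * x (snd e)) = card ?F" .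
    have "card ?F \<le> 2048 * card T' + card (crossing_pairs \<gamma> ?F)"
      using T F by (intro card_le_crossing_pairs[OF dr E]) (auto simp: T'_def)
    then show "0 \<le> f x" unfolding f_def 1 2 3 by linarith
  qed (use q in auto)
  also have "f (\<lambda>_. q) = q ^ 4 * card (crossing_pairs \<gamma> F) + 2048 * (q * card T) - q ^ 2 * card F"
    by (simp add: f_def split_def power4_eq_xxxx power2_eq_square mult_ac)
  finally show ?thesis by simp
qed

section \<open>Weighted graphs\<close>

text \<open>The powers below \<open>x\<close> form a series with ratio at most 1/2 and first term at
  most \<open>x\<close>. If \<open>x < 1\<close>, the term at 0 vanishes and division by
  \<open>q\<close> reduces to the threshold \<open>x / q\<close>.\<close>

lemma sum_geometric_levels_le:
  fixes q x :: real
  assumes q: "0 < q" "q \<le> 1/2" and x: "0 \<le> x"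
  shows "(\<Sum>i\<le>N. if q ^ i \<le> x then q ^ i else 0) \<le> 2 * x"
  using x
proof (induction N arbitrary: x)
  case 0
  then show ?case by (cases "1 \<le> x") (simp_all only: atMost_0, simp_all)
next
  case (Suc N)
  show ?case
  proof (cases "1 \<le> x")
    case True
    have "(\<Sum>i\<le>Suc N. if q ^ i \<le> x then q ^ i else 0) \<le> (\<Sum>i\<le>Suc N. (1/2) ^ i)"
      using q by (intro sum_mono) (auto intro: power_mono)
    also have "(\<Sum>i\<le>M. (1/2) ^ i) = (2 - (1/2) ^ M :: real)" for M
      by (induction M) simp_all
    finally have "(\<Sum>i\<le>Suc N. if q ^ i \<le> x then q ^ i else 0) \<le> 2 - (1/2) ^ Suc N" .
    moreover have "(0::real) < (1/2) ^ Suc N" by simp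
    ultimately show ?thesis using True by linarith
  next
    case False
    have "(\<Sum>i\<le>Suc N. if q ^ i \<le> x then q ^ i else 0)
       = (\<Sum>i\<le>N. if q * q ^ i \<le> x then q * q ^ i else 0)"
      using False by (subst sum.atMost_Suc_shift) (simp cong: if_cong)
    also have "\<dots> = q * (\<Sum>i\<le>N. if q ^ i \<le> x / q then q ^ i else 0)"
      using q unfolding sum_distrib_left by (intro sum.cong) (auto simp: field_simps)
    also have "\<dots> \<le> q * (2 * (x / q))"
      using q Suc by (intro mult_left_mono Suc.IH) auto
    finally show ?thesis using q by simp
  qed
qed

text \<open>The first power not exceeding \<open>x\<close> is already at least \<open>q * x\<close>,
  since the power before it exceeds \<open>x\<close>; \<open>q ^ N \<le> x\<close> places it within
  the sum.\<close>

lemma sum_geometric_levels_ge: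
  fixes q x :: real
  assumes q: "0 < q" "q \<le> 1" and x: "x \<le> 1" "q ^ N \<le> x"
  shows "q * x \<le> (\<Sum>i\<le>N. if q ^ i \<le> x then q ^ i else 0)"
proof -
  define i where "i = (LEAST i. q ^ i \<le> x)"
  have i: "q ^ i \<le> x" "i \<le> N" unfolding i_def using x(2) by (auto intro: LeastI Least_le)
  have "0 < q ^ i" using q by simp
  then have x0: "0 < x" using i(1) by linarith
  have "q * x \<le> q ^ i"
  proof (cases i)
    case 0
    have "q * x \<le> 1 * 1" using x0 x q by (intro mult_mono) auto
    then show ?thesis using 0 by simp
  next
    case (Suc j)
    then have "\<not> q ^ j \<le> x" using not_less_Least[of j "\<lambda>i. q ^ i \<le> x"] by (simp add: i_def)
    then show ?thesis using q Suc by simp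
  qed
  also have "\<dots> = (if q ^ i \<le> x then q ^ i else 0)" using i by simp
  also have "\<dots> \<le> (\<Sum>i\<le>N. if q ^ i \<le> x then q ^ i else 0)"
    using i q by (intro member_le_sum) auto
  finally show ?thesis .
qed

lemma sum_mult_card_levels:
  fixes c :: "'i \<Rightarrow> real"
  assumes "finite A"
  shows "(\<Sum>i\<in>I. c i * card {x \<in> A. P i x}) = (\<Sum>x\<in>A. \<Sum>i\<in>I. if P i x then c i else 0)"
proof -
  have "c i * card {x \<in> A. P i x} = (\<Sum>x\<in>A. if P i x then c i else 0)" for i
    using assms by (simp add: sum.If_cases Int_def)
  then show ?thesis by (simp add: sum.swap[of _ A])
qed

text \<open>Layer-cake decomposition into the level sets \<open>W \<ge> (1/4) ^ i\<close>; level \<open>i\<close> is sampled with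
  probability \<open>min 1 (\<sigma> * (1/2) ^ i)\<close>.\<close>
lemma weighted_crossing_pairs:
  fixes a :: "nat \<Rightarrow> real" and W :: "nat \<times> nat \<Rightarrow> real"
  assumes dr: "is_drawing V E p \<gamma>" and E: "E \<subseteq> {(u, v). u \<in> V \<and> v \<in> V \<and> u < v}"
    and V: "finite V" and a: "\<And>u. u \<in> V \<Longrightarrow> 0 \<le> a u" "\<And>u. u \<in> V \<Longrightarrow> a u \<le> 1"
    and W: "\<And>e. e \<in> E \<Longrightarrow> 0 \<le> W e" "\<And>e. e \<in> E \<Longrightarrow> W e \<le> a (fst e)"
      "\<And>e. e \<in> E \<Longrightarrow> W e \<le> a (snd e)"
    and \<sigma>: "0 < \<sigma>"
  shows "((\<Sum>e\<in>E. W e) / 4 - 4096 * (\<Sum>u\<in>V. a u) - 4096 / \<sigma> * (\<Sum>u\<in>V. sqrt (a u))) / (2 * \<sigma>\<^sup>2)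
    \<le> (\<Sum>(e, e')\<in>crossing_pairs \<gamma> E. W e * W e')"
proof -
  have finE: "finite E" using E V by (auto intro: finite_subset[of _ "V \<times> V"])
  define t s :: "nat \<Rightarrow> real" where "t i = (1/4) ^ i" and "s i = (1/2) ^ i" for i
  have pos: "0 < t i" "0 < s i" for i by (simp_all add: t_def s_def)
  have t_sq: "t i = (s i)\<^sup>2" for i by (simp add: t_def s_def power_mult[symmetric] power2_eq_square flip: power_mult_distrib)
  define q where "q i = min 1 (\<sigma> * s i)" for i
  have q: "0 < q i" "q i \<le> 1" "q i \<le> \<sigma> * s i" for i using \<sigma> pos by (simp_all add: q_def)
  \<comment> \<open>The factor left at the crossings of level \<open>i\<close> after scaling the
    sampling bound by \<open>t i / (\<sigma>\<^sup>2 * (q i)\<^sup>2)\<close>. It is at most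
    \<open>(t i)\<^sup>2\<close>, so its sum over levels is controlled by products of
    weights.\<close>
  define \<rho> where "\<rho> i = t i * (q i)\<^sup>2 / \<sigma>\<^sup>2" for i
  define EL where "EL i = {e \<in> E. t i \<le> W e}" for i
  define VL where "VL i = {u \<in> V. t i \<le> a u}" for i
  have WV: "fst e \<in> V" "snd e \<in> V" "W e \<le> 1" if "e \<in> E" for e
    using that E W(2)[OF that] a(2)[of "fst e"] by auto
  \<comment> \<open>Finitely many edges, so one level lies below all positive weights; the inserted
    1 keeps the minimum defined if there are none.\<close>
  obtain N where N: "t N \<le> W e" if "e \<in> E" "W e > 0" for e
  proof -
    define m where "m = Min (insert 1 (W ` {e \<in> E. 0 < W e}))"
    have fin: "finite (W ` {e \<in> E. 0 < W e})" using finE by simp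
    then have "0 < m" unfolding m_def by (subst Min_gr_iff) auto
    then obtain N where "(1/4) ^ N < m" using real_arch_pow_inv[of m "1/4"] by auto
    moreover have "m \<le> W e" if "e \<in> E" "W e > 0" for e
      using fin that unfolding m_def by (intro Min_le) auto
    ultimately show ?thesis using that[of N] unfolding t_def by fastforce
  qed
  have \<rho>: "0 \<le> \<rho> i" "\<rho> i \<le> (1/16) ^ i" for i
  proof -
    have "(q i)\<^sup>2 \<le> (\<sigma> * s i)\<^sup>2" using q[of i] by (intro power_mono) auto
    then have "t i * (q i)\<^sup>2 \<le> t i * (\<sigma>\<^sup>2 * t i)"
      using pos[of i] by (intro mult_left_mono) (auto simp: t_sq power_mult_distrib)
    then have "\<rho> i \<le> t i * (\<sigma>\<^sup>2 * t i) / \<sigma>\<^sup>2"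
      unfolding \<rho>_def by (intro divide_right_mono) auto
    also have "\<dots> = t i * t i" using \<sigma> by simp
    also have "\<dots> = (1/16) ^ i" by (simp add: t_def flip: power_mult_distrib)
    finally show "\<rho> i \<le> (1/16) ^ i" .
    show "0 \<le> \<rho> i" using pos[of i] by (simp add: \<rho>_def)
  qed
  \<comment> \<open>A pair survives at the levels up to the smaller weight \<open>m\<close>, where
    the squared levels sum to at most \<open>2 * m\<^sup>2\<close>.\<close>
  have pair: "(\<Sum>i\<le>N. if t i \<le> W e \<and> t i \<le> W e' then \<rho> i else 0) \<le> 2 * (W e * W e')"
    if "e \<in> E" "e' \<in> E" for e e'
  proof -
    define m where "m = min (W e) (W e')"
    have m: "0 \<le> m" using that W(1) by (simp add: m_def)
    have "(\<Sum>i\<le>N. if t i \<le> W e \<and> t i \<le> W e' then \<rho> i else 0)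
        \<le> (\<Sum>i\<le>N. if (1/16) ^ i \<le> m\<^sup>2 then (1/16) ^ i else 0)"
    proof (intro sum_mono)
      fix i
      have "(1/16) ^ i = (t i)\<^sup>2" by (simp add: t_def power2_eq_square flip: power_mult_distrib)
      then have "(1/16) ^ i \<le> m\<^sup>2" if "t i \<le> m"
        using that pos[of i] by (simp add: power_mono)
      then show "(if t i \<le> W e \<and> t i \<le> W e' then \<rho> i else 0) \<le> (if (1/16) ^ i \<le> m\<^sup>2 then (1/16) ^ i else 0)"
        using \<rho>[of i] by (auto simp: m_def)
    qed
    also have "\<dots> \<le> 2 * m\<^sup>2" by (rule sum_geometric_levels_le) auto
    also have "m\<^sup>2 \<le> W e * W e'"
      unfolding power2_eq_square using m W(1) that by (intro mult_mono) (auto simp: m_def)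
    finally show ?thesis by simp
  qed
  have level: "(t i * card (EL i) - 2048 * ((t i + s i / \<sigma>) * card (VL i))) / \<sigma>\<^sup>2
      \<le> \<rho> i * card (crossing_pairs \<gamma> (EL i))" for i
  proof -
    let ?x = "real (card (crossing_pairs \<gamma> (EL i)))" and ?e = "real (card (EL i))" and ?v = "real (card (VL i))"
    have "EL i \<subseteq> VL i \<times> VL i"
    proof
      fix e assume "e \<in> EL i"
      then have "e \<in> E" "t i \<le> W e" by (auto simp: EL_def)
      then have "fst e \<in> VL i" "snd e \<in> VL i"
        using WV[of e] W(2,3)[of e] by (auto simp: VL_def)
      then show "e \<in> VL i \<times> VL i" by (cases e) auto
    qed
    then have "(q i)\<^sup>2 * ?e \<le> (q i) ^ 4 * ?x + 2048 * (q i * ?v)"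
      using q[of i] V by (intro crossing_pairs_sampling[OF dr E]) (auto simp: VL_def EL_def)
    then have "t i / (\<sigma>\<^sup>2 * (q i)\<^sup>2) * ((q i)\<^sup>2 * ?e) \<le> t i / (\<sigma>\<^sup>2 * (q i)\<^sup>2) * ((q i) ^ 4 * ?x + 2048 * (q i * ?v))"
      using pos[of i] by (intro mult_left_mono) auto
    moreover have "t i / (\<sigma>\<^sup>2 * (q i)\<^sup>2) * ((q i)\<^sup>2 * ?e) = t i * ?e / \<sigma>\<^sup>2"
      using q(1)[of i] by simp
    moreover have "t i / (\<sigma>\<^sup>2 * (q i)\<^sup>2) * ((q i) ^ 4 * ?x + 2048 * (q i * ?v))
       = \<rho> i * ?x + 2048 * (t i / q i * ?v) / \<sigma>\<^sup>2"
      using q(1)[of i] \<sigma> by (simp add: \<rho>_def field_simps power2_eq_square power4_eq_xxxx)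
    \<comment> \<open>As \<open>q i\<close> is a minimum, \<open>t i / q i\<close> is the larger of
      \<open>t i\<close> and \<open>s i / \<sigma>\<close>.\<close>
    moreover have "t i / q i * ?v \<le> (t i + s i / \<sigma>) * ?v"
    proof (intro mult_right_mono)
      show "t i / q i \<le> t i + s i / \<sigma>"
        using pos[of i] \<sigma> by (auto simp: q_def min_def t_sq power2_eq_square)
    qed simp
    then have "2048 * (t i / q i * ?v) / \<sigma>\<^sup>2 \<le> 2048 * ((t i + s i / \<sigma>) * ?v) / \<sigma>\<^sup>2"
      by (intro divide_right_mono mult_left_mono) auto
    ultimately show ?thesis by (simp add: diff_divide_distrib)
  qed
  \<comment> \<open>The 1/4 is the loss from rounding a weight down to a power of 1/4.\<close>
  have sumE: "(\<Sum>e\<in>E. W e) / 4 \<le> (\<Sum>i\<le>N. t i * card (EL i))"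
  proof -
    have "(\<Sum>e\<in>E. W e) / 4 = (\<Sum>e\<in>E. 1/4 * W e)" by (simp add: sum_divide_distrib)
    also have "\<dots> \<le> (\<Sum>e\<in>E. \<Sum>i\<le>N. if t i \<le> W e then t i else 0)"
    proof (rule sum_mono)
      fix e assume e: "e \<in> E"
      show "1/4 * W e \<le> (\<Sum>i\<le>N. if t i \<le> W e then t i else 0)"
      proof (cases "W e = 0")
        case True
        then show ?thesis using pos by (auto intro!: sum_nonneg simp: less_imp_le)
      next
        case False
        then have "(1/4) ^ N \<le> W e" using N[OF e] W(1)[OF e] by (simp add: t_def)
        then show ?thesis
          unfolding t_def using WV(3)[OF e] by (intro sum_geometric_levels_ge) auto
      qed
    qed
    also have "\<dots> = (\<Sum>i\<le>N. t i * card (EL i))"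
      unfolding EL_def by (rule sum_mult_card_levels[OF finE, symmetric])
    finally show ?thesis .
  qed
  have sumV: "(\<Sum>i\<le>N. t i * card (VL i)) \<le> 2 * (\<Sum>u\<in>V. a u)"
    unfolding VL_def sum_mult_card_levels[OF V] sum_distrib_left
    unfolding t_def using a(1) by (intro sum_mono sum_geometric_levels_le) auto
  have t_le: "t i \<le> x \<longleftrightarrow> s i \<le> sqrt x" if "0 \<le> x" for i x
    using that pos[of i] by (metis t_sq real_le_rsqrt real_sqrt_le_iff real_sqrt_abs abs_of_pos)
  have "(\<Sum>i\<le>N. s i * card (VL i)) = (\<Sum>u\<in>V. \<Sum>i\<le>N. if t i \<le> a u then s i else 0)"
    unfolding VL_def by (rule sum_mult_card_levels[OF V])
  also have "\<dots> = (\<Sum>u\<in>V. \<Sum>i\<le>N. if s i \<le> sqrt (a u) then s i else 0)"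
    using t_le a(1) by (intro sum.cong) auto
  also have "\<dots> \<le> (\<Sum>u\<in>V. 2 * sqrt (a u))"
    unfolding s_def using a(1) by (intro sum_mono sum_geometric_levels_le) auto
  also have "\<dots> = 2 * (\<Sum>u\<in>V. sqrt (a u))"
    by (simp add: sum_distrib_left)
  finally have sumV': "(\<Sum>i\<le>N. s i * card (VL i)) \<le> 2 * (\<Sum>u\<in>V. sqrt (a u))" .
  have "((\<Sum>e\<in>E. W e) / 4 - 4096 * (\<Sum>u\<in>V. a u) - 4096 / \<sigma> * (\<Sum>u\<in>V. sqrt (a u))) / \<sigma>\<^sup>2
    \<le> ((\<Sum>i\<le>N. t i * card (EL i)) - 2048 * (\<Sum>i\<le>N. t i * card (VL i)) - 2048 / \<sigma> * (\<Sum>i\<le>N. s i * card (VL i))) / \<sigma>\<^sup>2"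
  proof (intro divide_right_mono)
    have "2048 / \<sigma> * (\<Sum>i\<le>N. s i * card (VL i)) \<le> 2048 / \<sigma> * (2 * (\<Sum>u\<in>V. sqrt (a u)))"
      using \<sigma> sumV' by (intro mult_left_mono) auto
    then show "(\<Sum>e\<in>E. W e) / 4 - 4096 * (\<Sum>u\<in>V. a u) - 4096 / \<sigma> * (\<Sum>u\<in>V. sqrt (a u))
      \<le> (\<Sum>i\<le>N. t i * card (EL i)) - 2048 * (\<Sum>i\<le>N. t i * card (VL i)) - 2048 / \<sigma> * (\<Sum>i\<le>N. s i * card (VL i))"
      using sumE sumV by simp
  qed simp
  also have "\<dots> = (\<Sum>i\<le>N. (t i * card (EL i) - 2048 * ((t i + s i / \<sigma>) * card (VL i))) / \<sigma>\<^sup>2)"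
    unfolding sum_distrib_left sum_subtractf[symmetric] sum_divide_distrib
    by (intro sum.cong) (simp_all add: algebra_simps)
  also have "\<dots> \<le> (\<Sum>i\<le>N. \<rho> i * card (crossing_pairs \<gamma> (EL i)))"
    by (intro sum_mono level)
  also have "\<dots> = (\<Sum>i\<le>N. \<rho> i * card {z \<in> crossing_pairs \<gamma> E. t i \<le> W (fst z) \<and> t i \<le> W (snd z)})"
    by (intro sum.cong refl arg_cong2[of _ _ _ _ "(*)"] arg_cong[of _ _ "\<lambda>x. real (card x)"])
       (auto simp: crossing_pairs_def EL_def)
  also have "\<dots> = (\<Sum>z\<in>crossing_pairs \<gamma> E. \<Sum>i\<le>N. if t i \<le> W (fst z) \<and> t i \<le> W (snd z) then \<rho> i else 0)"
    by (rule sum_mult_card_levels[OF finite_crossing_pairs[OF finE]])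
  also have "\<dots> \<le> (\<Sum>z\<in>crossing_pairs \<gamma> E. 2 * (W (fst z) * W (snd z)))"
    by (intro sum_mono pair) (auto simp: crossing_pairs_def)
  also have "\<dots> = 2 * (\<Sum>(e, e')\<in>crossing_pairs \<gamma> E. W e * W e')"
    by (simp add: sum_distrib_left split_def)
  finally show ?thesis using \<sigma> by (simp add: field_simps)
qed

section \<open>The complete graph weighted by a random set\<close>

lemma is_drawing_finite:
  assumes "is_drawing V E p \<gamma>" "e \<in> E" "e' \<in> E" "e \<noteq> e'"
  shows "finite (path_image (\<gamma> e) \<inter> path_image (\<gamma> e'))"
proof -
  have "\<forall>e\<in>E. \<forall>e'\<in>E. e \<noteq> e' \<longrightarrow> finite (path_image (\<gamma> e) \<inter> path_image (\<gamma> e'))"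
    using assms(1) unfolding is_drawing_def by (elim conjE)
  then show ?thesis using assms(2-4) by simp
qed

text \<open>A common point of disjoint edges is not a vertex, so it counts as a crossing; finiteness
  keeps \<open>card\<close> from being 0. Both sides sum over ordered pairs, which explains the
  1/2.\<close>

lemma crossing_weight_ge:
  assumes dr: "is_drawing V E p \<gamma>" and E: "E \<subseteq> V \<times> V" "finite E"
    and W: "\<And>e. e \<in> E \<Longrightarrow> 0 \<le> W e"
  shows "(\<Sum>(e, e')\<in>crossing_pairs \<gamma> E. W e * W e') / 2 \<le> crossing_weight V E W p \<gamma>"
proof -
  let ?P = "{(e, e'). e \<in> E \<and> e' \<in> E \<and> e \<noteq> e'}"
  have "(\<Sum>(e, e')\<in>crossing_pairs \<gamma> E. W e * W e')
      \<le> (\<Sum>(e, e')\<in>crossing_pairs \<gamma> E. W e * W e' * real (edge_crossings V p \<gamma> e e'))"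
  proof (intro sum_mono, clarify)
    fix a b c d assume "((a, b), c, d) \<in> crossing_pairs \<gamma> E"
    then have e: "(a, b) \<in> E" "(c, d) \<in> E" "{a, b} \<inter> {c, d} = {}"
      and "path_image (\<gamma> (a, b)) \<inter> path_image (\<gamma> (c, d)) \<noteq> {}"
      by (auto simp: crossing_pairs_def independent_crossing_def)
    then obtain z where z: "z \<in> path_image (\<gamma> (a, b))" "z \<in> path_image (\<gamma> (c, d))" by blast
    have "z \<notin> p ` V"
      using is_drawing_vertex_on_edge[OF dr E(1) e(1)] is_drawing_vertex_on_edge[OF dr E(1) e(2)]
        z e(3) by fastforce
    moreover have "finite (path_image (\<gamma> (a, b)) \<inter> path_image (\<gamma> (c, d)))"
      using is_drawing_finite[OF dr e(1,2)] e(3) by auto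
    ultimately have "edge_crossings V p \<gamma> (a, b) (c, d) > 0"
      using z unfolding edge_crossings_def by (subst card_gt_0_iff) auto
    then have "1 \<le> real (edge_crossings V p \<gamma> (a, b) (c, d))" by linarith
    then show "W (a, b) * W (c, d) \<le> W (a, b) * W (c, d) * real (edge_crossings V p \<gamma> (a, b) (c, d))"
      using W[OF e(1)] W[OF e(2)] mult_left_mono[of 1 _ "W (a, b) * W (c, d)"] by simp
  qed
  also have "\<dots> \<le> (\<Sum>(e, e')\<in>?P. W e * W e' * real (edge_crossings V p \<gamma> e e'))"
  proof (rule sum_mono2)
    show "finite ?P" by (rule finite_subset[of _ "E \<times> E"]) (use E in auto)
    show "crossing_pairs \<gamma> E \<subseteq> ?P" by (auto simp: crossing_pairs_def independent_crossing_def)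
  qed (auto intro!: mult_nonneg_nonneg W)
  finally show ?thesis unfolding crossing_weight_def by simp
qed

section \<open>A straight-line drawing of the complete graph\<close>

lemma closed_segment_parabola:
  assumes "z \<in> closed_segment (Complex u (u\<^sup>2)) (Complex v (v\<^sup>2))"
  shows "Im z = (u + v) * Re z - u * v"
proof -
  obtain t where z: "z = (1 - t) *\<^sub>R Complex u (u\<^sup>2) + t *\<^sub>R Complex v (v\<^sup>2)"
    using assms unfolding closed_segment_def by blast
  show ?thesis unfolding z by (simp add: algebra_simps power2_eq_square)
qed

text \<open>Places vertex \<open>x\<close> on the parabola at abscissa \<open>x\<close>: a chord
  meets the parabola only at its ends. Existence makes the infimum in the crossing number range over
  a nonempty set.\<close>

lemma drawing_Kn_exists: "\<exists>p \<gamma>. is_drawing {1..n} (Kn_edges n) p \<gamma>"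
proof (intro exI)
  define P :: "nat \<Rightarrow> complex" where "P x = Complex (real x) ((real x)\<^sup>2)" for x
  define \<gamma> where "\<gamma> e = linepath (P (fst e)) (P (snd e))" for e
  have inj: "P x = P y \<longleftrightarrow> x = y" for x y by (auto simp: P_def)
  have seg: "Im z = (real u + real v) * Re z - real u * real v" if "z \<in> path_image (\<gamma> (u, v))" for z u v
    using that by (intro closed_segment_parabola) (simp add: \<gamma>_def P_def)
  have vertex: "w = u \<or> w = v" if "P w \<in> path_image (\<gamma> (u, v))" for u v w
  proof -
    have "(real w - real u) * (real w - real v) = 0"
      using seg[OF that] by (simp add: P_def algebra_simps power2_eq_square)
    then show ?thesis by auto
  qed
  have "finite (path_image (\<gamma> e) \<inter> path_image (\<gamma> e'))"
    if "e \<in> Kn_edges n" "e' \<in> Kn_edges n" "e \<noteq> e'" for e e'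
  proof -
    obtain u v x y where e: "e = (u, v)" "e' = (x, y)" by (metis prod.exhaust)
    have lt: "u < v" "x < y" using that by (auto simp: e Kn_edges_def)
    have "z = w" if z: "z \<in> path_image (\<gamma> e) \<inter> path_image (\<gamma> e')" and w: "w \<in> path_image (\<gamma> e) \<inter> path_image (\<gamma> e')" for z w
    proof -
      have eqs: "Im z = (real u + real v) * Re z - real u * real v" "Im z = (real x + real y) * Re z - real x * real y"
        "Im w = (real u + real v) * Re w - real u * real v" "Im w = (real x + real y) * Re w - real x * real y"
        using seg z w by (auto simp: e)
      \<comment> \<open>Equal slopes and a common point force equal intercepts, so sum and product
        of the abscissae agree and the chords coincide.\<close>
      have "real u + real v \<noteq> real x + real y"
      proof
        assume sum: "real u + real v = real x + real y"
        then have "real u * real v = real x * real y" using eqs(1,2) by simp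
        then have "(real u - real x) * (real u - real y) = 0"
          using sum by algebra
        then have "u = x \<or> u = y" by auto
        then show False using sum lt \<open>e \<noteq> e'\<close> by (auto simp: e)
      qed
      moreover have "((real u + real v) - (real x + real y)) * (Re z - Re w) = 0"
        using eqs by (simp add: algebra_simps)
      ultimately have "Re z = Re w" by simp
      then show "z = w" using eqs(1,3) by (simp add: complex_eq_iff)
    qed
    then have "path_image (\<gamma> e) \<inter> path_image (\<gamma> e') = {} \<or> (\<exists>z. path_image (\<gamma> e) \<inter> path_image (\<gamma> e') \<subseteq> {z})"
      by blast
    then show ?thesis by (auto intro: finite_subset)
  qed
  moreover have "arc (\<gamma> (u, v)) \<and> pathstart (\<gamma> (u, v)) = P u \<and> pathfinish (\<gamma> (u, v)) = P v \<and>
      path_image (\<gamma> (u, v)) \<inter> P ` {1..n} \<subseteq> {P u, P v}" if "(u, v) \<in> Kn_edges n" for u v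
    using that vertex[of _ u v] by (auto simp: \<gamma>_def inj Kn_edges_def intro!: arc_linepath)
  ultimately show "is_drawing {1..n} (Kn_edges n) P \<gamma>"
    unfolding is_drawing_def by (auto simp: inj inj_on_def)
qed

section \<open>Moments of the random set\<close>

lemma Kn_edges_restrict:
  assumes "S \<subseteq> {1..n}"
  shows "2 * real (card {e \<in> Kn_edges n. fst e \<in> S \<and> snd e \<in> S}) = real (card S) ^ 2 - real (card S)"
proof -
  let ?L = "{e \<in> Kn_edges n. fst e \<in> S \<and> snd e \<in> S}"
  have "?L \<subseteq> {1..n} \<times> {1..n}" by (auto simp: Kn_edges_def)
  then have fin: "finite S" "finite ?L"
    using assms by (auto intro: finite_subset)
  \<comment> \<open>The two orientations of every edge inside \<open>S\<close>, together with the
    diagonal.\<close>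
  have "S \<times> S = (?L \<union> prod.swap ` ?L) \<union> (\<lambda>x. (x, x)) ` S"
    using assms by (fastforce simp: Kn_edges_def image_iff)
  then have "card S * card S = card ((?L \<union> prod.swap ` ?L) \<union> (\<lambda>x. (x, x)) ` S)"
    by (metis card_cartesian_product)
  also have "\<dots> = card (?L \<union> prod.swap ` ?L) + card ((\<lambda>x. (x, x)) ` S)"
    using fin by (intro card_Un_disjoint) (auto simp: Kn_edges_def)
  also have "card (?L \<union> prod.swap ` ?L) = card ?L + card (prod.swap ` ?L)"
    using fin by (intro card_Un_disjoint) (auto simp: Kn_edges_def)
  also have "card (prod.swap ` ?L) = card ?L" by (simp add: card_image)
  also have "card ((\<lambda>x. (x, x)) ` S) = card S" by (simp add: card_image inj_on_def)
  finally show ?thesis by (simp add: power2_eq_square flip: of_nat_mult of_nat_add)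
qed

lemma sum_prob_pmf:
  assumes "finite (set_pmf \<mu>)" "finite A"
  shows "(\<Sum>x\<in>A. measure_pmf.prob \<mu> {S. Q x S}) = measure_pmf.expectation \<mu> (\<lambda>S. real (card {x \<in> A. Q x S}))"
proof -
  have int: "integrable (measure_pmf \<mu>) f" for f :: "'a \<Rightarrow> real"
    using assms(1) by (rule integrable_measure_pmf_finite)
  have "(\<Sum>x\<in>A. measure_pmf.prob \<mu> {S. Q x S})
      = (\<Sum>x\<in>A. measure_pmf.expectation \<mu> (\<lambda>S. of_bool (Q x S)))"
  proof (rule sum.cong[OF refl])
    fix x
    have "(\<lambda>S. of_bool (Q x S) :: real) = indicator {S. Q x S}" by (auto simp: indicator_def)
    then show "measure_pmf.prob \<mu> {S. Q x S} = measure_pmf.expectation \<mu> (\<lambda>S. of_bool (Q x S))"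
      by simp
  qed
  also have "\<dots> = measure_pmf.expectation \<mu> (\<lambda>S. \<Sum>x\<in>A. of_bool (Q x S))"
    using int by (subst Bochner_Integration.integral_sum) auto
  also have "(\<lambda>S. \<Sum>x\<in>A. of_bool (Q x S) :: real) = (\<lambda>S. real (card {x \<in> A. Q x S}))"
    using assms(2) by (auto simp: Int_def)
  finally show ?thesis .
qed

lemma expectation_pmf_cong:
  assumes "\<And>x. x \<in> set_pmf \<mu> \<Longrightarrow> f x = g x"
  shows "measure_pmf.expectation \<mu> f = measure_pmf.expectation \<mu> (g :: _ \<Rightarrow> real)"
  using assms by (intro integral_cong_AE) (auto simp: AE_measure_pmf_iff)

lemma expectation_pmf_le_sqrt:
  fixes f :: "'a \<Rightarrow> real"
  assumes "finite (set_pmf \<mu>)"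
  shows "measure_pmf.expectation \<mu> f \<le> sqrt (measure_pmf.expectation \<mu> (\<lambda>x. f x ^ 2))"
proof -
  have int: "integrable (measure_pmf \<mu>) h" for h :: "'a \<Rightarrow> real"
    using assms by (rule integrable_measure_pmf_finite)
  have "0 \<le> measure_pmf.variance \<mu> f" by (rule measure_pmf.variance_positive)
  then show ?thesis using measure_pmf.variance_eq[OF int int, of f] by (intro real_le_rsqrt) simp
qed

lemma sum_sqrt_le:
  assumes "\<And>x. x \<in> A \<Longrightarrow> 0 \<le> f x"
  shows "(\<Sum>x\<in>A. sqrt (f x)) \<le> sqrt (real (card A) * (\<Sum>x\<in>A. f x))"
proof -
  have "(\<Sum>x\<in>A. sqrt (f x))\<^sup>2 \<le> (\<Sum>x\<in>A. (sqrt (f x))\<^sup>2) * card A"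
    by (rule sum_squared_le_sum_of_squares)
  also have "(\<Sum>x\<in>A. (sqrt (f x))\<^sup>2) = (\<Sum>x\<in>A. f x)" using assms by (intro sum.cong) auto
  finally show ?thesis by (intro real_le_rsqrt) (simp add: mult.commute)
qed

lemma crossing_weight_lower_bound:
  fixes \<mu> :: "nat set pmf"
  defines "W \<equiv> \<lambda>(u, v). measure_pmf.prob \<mu> {S. u \<in> S \<and> v \<in> S}"
  assumes n: "n \<ge> 1" and \<mu>: "set_pmf \<mu> \<subseteq> Pow {1..n}"
    and M: "2 ^ 36 \<le> measure_pmf.expectation \<mu> (\<lambda>S. real (card S) ^ 2)"
    and dr: "is_drawing {1..n} (Kn_edges n) p \<gamma>"
  shows "1 / 2 ^ 43 / real n * measure_pmf.expectation \<mu> (\<lambda>S. real (card S) ^ 2) powr (5/2)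
    \<le> crossing_weight {1..n} (Kn_edges n) W p \<gamma>"
proof -
  define M where "M = measure_pmf.expectation \<mu> (\<lambda>S. real (card S) ^ 2)"
  define M1 where "M1 = measure_pmf.expectation \<mu> (\<lambda>S. real (card S))"
  define a where "a u = measure_pmf.prob \<mu> {S. u \<in> S}" for u
  \<comment> \<open>With \<open>r\<close> all relevant powers of \<open>M\<close> have integer
    exponents: \<open>sqrt M = r ^ 2\<close> and \<open>M powr (5/2) = r ^ 10\<close>.\<close>
  define r where "r = M powr (1/4)"
  have fin: "finite (set_pmf \<mu>)" using \<mu> by (rule finite_subset) simp
  have int: "integrable (measure_pmf \<mu>) f" for f :: "nat set \<Rightarrow> real"
    using fin by (rule integrable_measure_pmf_finite)
  have E: "Kn_edges n \<subseteq> {1..n} \<times> {1..n}" "Kn_edges n \<subseteq> {(u, v). u \<in> {1..n} \<and> v \<in> {1..n} \<and> u < v}"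
    by (auto simp: Kn_edges_def)
  have finE: "finite (Kn_edges n)" by (rule finite_subset[OF E(1)]) simp
  have M_pos: "0 < M" "2 ^ 36 \<le> M" using M by (auto simp: M_def)
  have r_pow: "r ^ k = M powr (k / 4)" for k
    using M_pos by (simp add: r_def powr_realpow[symmetric] powr_powr)
  have r: "0 < r" "r ^ 4 = M" "r ^ 10 = M powr (5/2)"
    using M_pos r_pow[of 4] r_pow[of 10] by (simp_all add: r_def)
  have r2: "2 ^ 18 \<le> r ^ 2"
  proof (rule power2_le_imp_le)
    show "(2 ^ 18)\<^sup>2 \<le> (r ^ 2)\<^sup>2" using r(2) M_pos by simp
  qed simp
  have sum_a: "(\<Sum>u\<in>{1..n}. a u) = M1"
  proof -
    have "card {u \<in> {1..n}. u \<in> S} = card S" if "S \<in> set_pmf \<mu>" for S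
    proof -
      have "S \<subseteq> {1..n}" using \<mu> that by blast
      then have "{u \<in> {1..n}. u \<in> S} = S" by blast
      then show ?thesis by simp
    qed
    then show ?thesis
      unfolding a_def M1_def sum_prob_pmf[OF fin finite_atLeastAtMost]
      by (intro expectation_pmf_cong) simp
  qed
  have sum_W: "(\<Sum>e\<in>Kn_edges n. W e) = (M - M1) / 2"
  proof -
    have "(\<Sum>e\<in>Kn_edges n. W e)
        = (\<Sum>e\<in>Kn_edges n. measure_pmf.prob \<mu> {S. fst e \<in> S \<and> snd e \<in> S})"
      by (simp add: W_def split_def)
    also have "\<dots> = measure_pmf.expectation \<mu> (\<lambda>S. (real (card S) ^ 2 - real (card S)) / 2)"
      unfolding sum_prob_pmf[OF fin finE]
    proof (rule expectation_pmf_cong)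
      fix S assume "S \<in> set_pmf \<mu>"
      then have "S \<subseteq> {1..n}" using \<mu> by blast
      from Kn_edges_restrict[OF this]
      show "real (card {e \<in> Kn_edges n. fst e \<in> S \<and> snd e \<in> S}) = (real (card S) ^ 2 - real (card S)) / 2"
        by simp
    qed
    also have "\<dots> = (M - M1) / 2"
      unfolding M_def M1_def using int by simp
    finally show ?thesis .
  qed
  have M1: "M1 \<le> r ^ 2"
  proof -
    have "M1 \<le> sqrt M" unfolding M1_def M_def by (rule expectation_pmf_le_sqrt[OF fin])
    also have "sqrt M = r ^ 2" using r by (intro real_sqrt_unique) (simp_all flip: power_mult)
    finally show ?thesis .
  qed
  have sum_sqrt: "(\<Sum>u\<in>{1..n}. sqrt (a u)) \<le> sqrt n * r"
  proof -
    have "(\<Sum>u\<in>{1..n}. sqrt (a u)) \<le> sqrt (n * M1)"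
      using sum_sqrt_le[of "{1..n}" a] by (simp add: a_def flip: sum_a)
    also have "\<dots> \<le> sqrt (n * r ^ 2)" using M1 by (intro real_sqrt_le_mono mult_left_mono) auto
    finally show ?thesis using r by (simp add: real_sqrt_mult)
  qed
  \<comment> \<open>Chosen so that the term with the square roots is at most
    \<open>4096 / \<sigma> * (sqrt n * r) = M / 64\<close>.\<close>
  define \<sigma> where "\<sigma> = 2 ^ 18 * sqrt n / r ^ 3"
  have \<sigma>: "0 < \<sigma>" using n r by (simp add: \<sigma>_def)
  have pairs: "((\<Sum>e\<in>Kn_edges n. W e) / 4 - 4096 * (\<Sum>u\<in>{1..n}. a u)
      - 4096 / \<sigma> * (\<Sum>u\<in>{1..n}. sqrt (a u))) / (2 * \<sigma>\<^sup>2)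
    \<le> (\<Sum>(e, e')\<in>crossing_pairs \<gamma> (Kn_edges n). W e * W e')"
  proof (rule weighted_crossing_pairs[OF dr E(2) _ _ _ _ _ _ \<sigma>])
    show "W e \<le> a (fst e)" "W e \<le> a (snd e)" for e
      by (auto simp: W_def a_def split_def intro!: measure_pmf.finite_measure_mono)
  qed (auto simp: a_def W_def split_def)
  have "M / (64 * \<sigma>\<^sup>2) \<le> ((\<Sum>e\<in>Kn_edges n. W e) / 4 - 4096 * (\<Sum>u\<in>{1..n}. a u)
      - 4096 / \<sigma> * (\<Sum>u\<in>{1..n}. sqrt (a u))) / (2 * \<sigma>\<^sup>2)"
  proof -
    define B where "B = 4096 / \<sigma> * (\<Sum>u\<in>{1..n}. sqrt (a u))"
    have "B \<le> 4096 / \<sigma> * (sqrt n * r)"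
      unfolding B_def using \<sigma> sum_sqrt by (intro mult_left_mono) auto
    also have "\<dots> = M / 64"
      using n r by (simp add: \<sigma>_def field_simps power4_eq_xxxx power3_eq_cube flip: r(2))
    finally have "B \<le> M / 64" .
    moreover have "2 ^ 18 * r ^ 2 \<le> M"
      using mult_right_mono[OF r2, of "r ^ 2"] by (simp add: r(2) flip: power_add)
    then have "262144 * M1 \<le> M" using M1 by simp
    \<comment> \<open>From \<open>M / 8\<close> one loses \<open>M / 64\<close> for \<open>B\<close>
      and little more than \<open>M / 64\<close> for the terms in \<open>M1\<close>; this is where
      \<open>M \<ge> 2 ^ 36\<close> enters.\<close>
    ultimately have "M / 32 \<le> (M - M1) / 2 / 4 - 4096 * M1 - B"
      using M_pos(1) by (simp add: field_simps)
    then have "M / 32 \<le> (\<Sum>e\<in>Kn_edges n. W e) / 4 - 4096 * (\<Sum>u\<in>{1..n}. a u)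
      - 4096 / \<sigma> * (\<Sum>u\<in>{1..n}. sqrt (a u))"
      unfolding sum_a sum_W B_def .
    then have "M / 32 / (2 * \<sigma>\<^sup>2) \<le> ((\<Sum>e\<in>Kn_edges n. W e) / 4 - 4096 * (\<Sum>u\<in>{1..n}. a u)
      - 4096 / \<sigma> * (\<Sum>u\<in>{1..n}. sqrt (a u))) / (2 * \<sigma>\<^sup>2)"
      by (intro divide_right_mono) auto
    then show ?thesis by simp
  qed
  also note pairs
  finally have "M / (64 * \<sigma>\<^sup>2) / 2 \<le> (\<Sum>(e, e')\<in>crossing_pairs \<gamma> (Kn_edges n). W e * W e') / 2"
    by (rule divide_right_mono) simp
  \<comment> \<open>Here \<open>\<sigma>\<^sup>2 = 2 ^ 36 * n / r ^ 6\<close>; the remaining halving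
    turns \<open>2 ^ 42\<close> into the final constant \<open>2 ^ 43\<close>.\<close>
  also have "M / (64 * \<sigma>\<^sup>2) = r ^ 10 / (2 ^ 42 * n)"
    using n r(1) by (simp add: \<sigma>_def power_divide power_mult_distrib flip: r(2) power_mult power_add)
  also have "(\<Sum>(e, e')\<in>crossing_pairs \<gamma> (Kn_edges n). W e * W e') / 2
      \<le> crossing_weight {1..n} (Kn_edges n) W p \<gamma>"
    by (rule crossing_weight_ge[OF dr E(1) finE]) (auto simp: W_def)
  finally show ?thesis unfolding r(3) M_def by simp
qed

theorem theorem1p3:
  shows "\<exists>C::real. C \<ge> 1 \<and> (\<exists>c::real. c > 0 \<and>
     (\<forall>(n::nat) (\<mu>::nat set pmf).
        n \<ge> 1 \<longrightarrow> set_pmf \<mu> \<subseteq> Pow {1..n} \<longrightarrow>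
        measure_pmf.expectation \<mu> (\<lambda>S. real (card S) ^ 2) \<ge> C \<longrightarrow>
        weighted_crossing_number {1..n} (Kn_edges n)
            (\<lambda>(u, v). measure_pmf.prob \<mu> {S. u \<in> S \<and> v \<in> S})
          \<ge> c / real n * (measure_pmf.expectation \<mu> (\<lambda>S. real (card S) ^ 2)) powr (5/2)))"
proof (rule exI[of _ "2 ^ 36"], intro conjI exI[of _ "1 / 2 ^ 43"] allI impI)
  fix n :: nat and \<mu> :: "nat set pmf"
  assume a: "n \<ge> 1" "set_pmf \<mu> \<subseteq> Pow {1..n}"
    "measure_pmf.expectation \<mu> (\<lambda>S. real (card S) ^ 2) \<ge> 2 ^ 36"
  show "weighted_crossing_number {1..n} (Kn_edges n)
            (\<lambda>(u, v). measure_pmf.prob \<mu> {S. u \<in> S \<and> v \<in> S})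
          \<ge> 1 / 2 ^ 43 / real n * (measure_pmf.expectation \<mu> (\<lambda>S. real (card S) ^ 2)) powr (5/2)"
    unfolding weighted_crossing_number_def
  proof (rule cInf_greatest)
    show "{crossing_weight {1..n} (Kn_edges n) (\<lambda>(u, v). measure_pmf.prob \<mu> {S. u \<in> S \<and> v \<in> S}) p \<gamma> |p \<gamma>.
        is_drawing {1..n} (Kn_edges n) p \<gamma>} \<noteq> {}"
      using drawing_Kn_exists[of n] by blast
  qed (use crossing_weight_lower_bound[OF a] in blast)
qed simp_all

end
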